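(* Let $E$ be a finite directed graph without sinks or sources in which every cycle has an exit, and let $\mathcal J$ be an admissible set of pairs of paths, with unitary $u_{\mathcal J}\in L_{\mathbb Z}(E)$. Assume that the coding graph $E_{\mathcal J}$ has only non-negative edges and does not contain any non-positive cycles. If $(E_{\mathcal J},\mathcal E)$ is not left-synchronizing, then $\Lambda_{\mathcal J}$ does not restrict to an isomorphism of the diagonal subalgebra $\mathcal D_{L_{\mathbb Z}(E)}$ (onto itself).
   Context: Graphs and algebras. $E=(E^0,E^1,r,s)$ is a finite directed graph (multiple edges allowed) with range and source maps $r,s$; no sinks (every vertex emits an edge), no sources (every vertex receives an edge). A path $\mu=\mu_1\cdots\mu_k$ is a sequence of edges with $r(\mu_j)=s(\mu_{j+1})$, of length $|\mu|=k$; vertices are paths of length $0$; $E^*$ is the set of finite paths. A cycle is a path of length $\ge1$ with equal source and range; it has an exit if the source of one of its edges emits at least two distinct edges. $L_{\mathbb Z}(E)$ is the universal $\mathbb Z$-algebra generated by pairwise orthogonal idempotents $P_v$ ($v\in E^0$) and elements $S_e,S_e^*$ ($e\in E^1$) subject to $S_e^*S_f=0$ for $e\ne f$, $S_e^*S_e=P_{r(e)}$, $P_{s(e)}S_e=S_e=S_eP_{r(e)}$, $S_e^*P_{s(e)}=S_e^*=P_{r(e)}S_e^*$, and $P_v=\sum_{s(e)=v}S_eS_e^*$; it is a unital $*$-algebra. $S_\mu=S_{\mu_1}\cdots S_{\mu_k}$, $S_v=P_v$ for $v\in E^0$, $P_\mu=S_\mu S_\mu^*$. The diagonal $\mathcal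 D_{L_{\mathbb Z}(E)}$ is the $\mathbb Z$-span of $\{P_\mu:\mu\in E^*\}$. Admissible sets and endomorphisms. An admissible set is a finite $\mathcal J\subseteq E^*\times E^*$ such that $s(\mu)=s(\nu)$, $r(\mu)=r(\nu)$, $|\nu|\ge 1$ for all $(\mu,\nu)\in\mathcal J$ and $u_{\mathcal J}=\sum_{(\mu,\nu)\in\mathcal J}S_\mu S_\nu^*$ is unitary in $L_{\mathbb Z}(E)$ (equivalently: distinct pairs have distinct first components and distinct second components, and the $P_\mu$ over first components sum to $1$, as do the $P_\nu$ over second components). Elements of $\mathcal J$ are written $(\mu,e\nu)$ with $e\in E^1$, $\nu\in E^*$ ($\nu=r(e)$ if the second component is a single edge). $\Lambda_{\mathcal J}$ is the unital $*$-endomorphism of $L_{\mathbb Z}(E)$ with $\Lambda_{\mathcal J}(S_e)=u_{\mathcal J}S_e$ and $\Lambda_{\mathcal J}(P_v)=P_v$; it is injective and maps $\mathcal D_{L_{\mathbb Z}(E)}$ into itself, so it restricts to an isomorphism of the diagonal if and only if $\Lambda_{\mathcal J}(\mathcal D_{L_{\mathbb Z}(E)})=\mathcal D_{L_{\mathbb Z}(E)}$. Coding graph. $E_{\mathcal J}$ has vertex set $\mathcal J$, and exactly one edge $[(\mu_1,e_1\nu_1),(\mu_2,e_2\nu_2)]$ from $(\mu_1,e_1\nu_1)$ to $(\mu_2,e_2\nu_2)$ whenever $S_{\nu_1}^*S_{\mu_2}\neq0$; its label is $\mathcal L_{\mathcal J}=S_{\nu_1}^*S_{\mu_2}$, which is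 of the form $S_\alpha$ ($|\alpha|\geq 1$), $P_v$, or $S_\alpha^*$ ($|\alpha|\ge1$). The degree of the edge is $|\alpha|$, $0$, $-|\alpha|$ respectively. An edge is non-negative if its degree is $\ge0$; a path (in particular a cycle) in $E_{\mathcal J}$ is non-positive if all its edges have degree $\le0$. For a path $\omega$ in $E_{\mathcal J}$ visiting successively the vertices $(\mu_1,e_1\nu_1),\dots,(\mu_k,e_k\nu_k)$, $\mathcal E(\omega)=e_1e_2\cdots e_k\in E^*$. Left-synchronizing. $(E_{\mathcal J},\mathcal E)$ is left-synchronizing if there is $m\in\mathbb N$ (the delay) such that for any two paths $\omega_1,\omega_2$ of length $m$ in $E_{\mathcal J}$, $\mathcal E(\omega_1)=\mathcal E(\omega_2)$ implies $s(\omega_1)=s(\omega_2)$. *)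

theory Defs
  imports
    "Graph_Theory.Arc_Walk"
    "HOL-Library.Poly_Mapping"
    "HOL-Algebra.QuotRing"
    "HOL-Algebra.Generated_Groups"
begin

section \<open>Directed graphs and paths\<close>

text \<open>
  A finite directed graph \<open>E\<close> is a \<^locale>\<open>fin_digraph\<close>, with source map \<^term>\<open>tail E\<close> and
  range map \<^term>\<open>head E\<close>; parallel arcs and loops are allowed.
  A path \<open>(v, es)\<close> is its source together with its list of edges; the
  path \<open>(v, [])\<close> is the vertex \<open>v\<close>.
\<close>

type_synonym ('v, 'e) path = "'v \<times> 'e list"

definition paths :: "('v, 'e) pre_digraph \<Rightarrow> ('v, 'e) path set" where
  "paths E = {(v, es). \<exists>w. pre_digraph.awalk E v es w}"

definition path_src :: "('v, 'e) path \<Rightarrow> 'v" where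
  "path_src \<mu> = fst \<mu>"

definition path_rng :: "('v, 'e) pre_digraph \<Rightarrow> ('v, 'e) path \<Rightarrow> 'v" where
  "path_rng E \<mu> = pre_digraph.awlast E (fst \<mu>) (snd \<mu>)"

definition path_length :: "('v, 'e) path \<Rightarrow> nat" where
  "path_length \<mu> = length (snd \<mu>)"

definition no_sinks :: "('v, 'e) pre_digraph \<Rightarrow> bool" where
  "no_sinks E \<longleftrightarrow> (\<forall>v\<in>verts E. out_arcs E v \<noteq> {})"

definition no_sources :: "('v, 'e) pre_digraph \<Rightarrow> bool" where
  "no_sources E \<longleftrightarrow> (\<forall>v\<in>verts E. in_arcs E v \<noteq> {})"

text \<open>
  Cycles are closed walks of positive length (\<^const>\<open>wf_digraph.closed_w\<close>); in contrast to
  \<^const>\<open>pre_digraph.cycle\<close>, vertices may be repeated.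
\<close>

definition every_cycle_has_exit :: "('v, 'e) pre_digraph \<Rightarrow> bool" where
  "every_cycle_has_exit E \<longleftrightarrow>
     (\<forall>p. wf_digraph.closed_w E p \<longrightarrow>
        (\<exists>e\<in>set p. \<exists>f\<in>out_arcs E (tail E e). \<exists>g\<in>out_arcs E (tail E e). f \<noteq> g))"


section \<open>The free ring on the generators of the Leavitt path algebra\<close>

datatype 'a free_word = Word (letters: "'a list")

instantiation free_word :: (type) monoid_add
begin

definition zero_free_word :: "'a free_word" where
  "0 = Word []"

definition plus_free_word :: "'a free_word \<Rightarrow> 'a free_word \<Rightarrow> 'a free_word" where
  "x + y = Word (letters x @ letters y)"

instance
  by standard (simp_all add: zero_free_word_def plus_free_word_def)

end

text \<open>The generators \<open>P\<^sub>v\<close>, \<open>S\<^sub>e\<close> and \<open>S\<^sub>e\<^sup>*\<close>, respectively.\<close>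

datatype ('v, 'e) gen = Vert 'v | Edge 'e | Ghost 'e

definition gens :: "('v, 'e) pre_digraph \<Rightarrow> ('v, 'e) gen set" where
  "gens E = Vert ` verts E \<union> Edge ` arcs E \<union> Ghost ` arcs E"

text \<open>
  Concatenation of words being addition on \<^typ>\<open>'a free_word\<close>, the convolution product of
  \<^typ>\<open>'a free_word \<Rightarrow>\<^sub>0 int\<close> is the multiplication of noncommutative integer polynomials.
\<close>

type_synonym ('v, 'e) ncpoly = "('v, 'e) gen free_word \<Rightarrow>\<^sub>0 int"

definition free_ring :: "('v, 'e) pre_digraph \<Rightarrow> ('v, 'e) ncpoly ring" where
  "free_ring E =
     \<lparr>carrier = {f. \<forall>w\<in>Poly_Mapping.keys f. set (letters w) \<subseteq> gens E},
      monoid.mult = (*), one = 1, zero = 0, add = (+)\<rparr>"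

definition gen_poly :: "('v, 'e) gen \<Rightarrow> ('v, 'e) ncpoly" where
  "gen_poly g = Poly_Mapping.single (Word [g]) 1"

abbreviation pV :: "'v \<Rightarrow> ('v, 'e) ncpoly" where
  "pV v \<equiv> gen_poly (Vert v)"

abbreviation sE :: "'e \<Rightarrow> ('v, 'e) ncpoly" where
  "sE e \<equiv> gen_poly (Edge e)"

abbreviation sG :: "'e \<Rightarrow> ('v, 'e) ncpoly" where
  "sG e \<equiv> gen_poly (Ghost e)"

text \<open>
  Each member of the following set is to become \<open>0\<close>. The last relation says that the unit of
  the free ring becomes \<open>\<Sum>\<^sub>v P\<^sub>v\<close>, which by the other relations is the unit of the
  universal algebra generated by the \<open>P\<^sub>v\<close>, \<open>S\<^sub>e\<close> and \<open>S\<^sub>e\<^sup>*\<close> (there are only finitely many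
  vertices). It is needed because the free ring is taken with a unit.
\<close>

definition leavitt_relations :: "('v, 'e) pre_digraph \<Rightarrow> ('v, 'e) ncpoly set" where
  "leavitt_relations E =
     {pV v * pV v - pV v |v. v \<in> verts E}
   \<union> {pV v * pV w |v w. v \<in> verts E \<and> w \<in> verts E \<and> v \<noteq> w}
   \<union> {sG e * sE f |e f. e \<in> arcs E \<and> f \<in> arcs E \<and> e \<noteq> f}
   \<union> {sG e * sE e - pV (head E e) |e. e \<in> arcs E}
   \<union> {pV (tail E e) * sE e - sE e |e. e \<in> arcs E}
   \<union> {sE e * pV (head E e) - sE e |e. e \<in> arcs E}
   \<union> {sG e * pV (tail E e) - sG e |e. e \<in> arcs E}
   \<union> {pV (head E e) * sG e - sG e |e. e \<in> arcs E}
   \<union> {pV v - (\<Sum>e\<in>out_arcs E v. sE e * sG e) |v. v \<in> verts E}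
   \<union> {(\<Sum>v\<in>verts E. pV v) - 1}"


section \<open>The Leavitt path algebra over the integers\<close>

definition leavitt_ideal :: "('v, 'e) pre_digraph \<Rightarrow> ('v, 'e) ncpoly set" where
  "leavitt_ideal E = genideal (free_ring E) (leavitt_relations E)"

definition leavitt :: "('v, 'e) pre_digraph \<Rightarrow> ('v, 'e) ncpoly set ring" where
  "leavitt E = free_ring E Quot leavitt_ideal E"

definition leavitt_class :: "('v, 'e) pre_digraph \<Rightarrow> ('v, 'e) ncpoly \<Rightarrow> ('v, 'e) ncpoly set" where
  "leavitt_class E f = leavitt_ideal E +>\<^bsub>free_ring E\<^esub> f"

definition P_vert :: "('v, 'e) pre_digraph \<Rightarrow> 'v \<Rightarrow> ('v, 'e) ncpoly set" where
  "P_vert E v = leavitt_class E (pV v)"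

definition S_edge :: "('v, 'e) pre_digraph \<Rightarrow> 'e \<Rightarrow> ('v, 'e) ncpoly set" where
  "S_edge E e = leavitt_class E (sE e)"

fun gen_star :: "('v, 'e) gen \<Rightarrow> ('v, 'e) gen" where
  "gen_star (Vert v) = Vert v"
| "gen_star (Edge e) = Ghost e"
| "gen_star (Ghost e) = Edge e"

definition word_star :: "('v, 'e) gen free_word \<Rightarrow> ('v, 'e) gen free_word" where
  "word_star w = Word (rev (map gen_star (letters w)))"

text \<open>As \<^const>\<open>word_star\<close> is an involution, \<^term>\<open>Poly_Mapping.map_key word_star\<close> moves
  the coefficient of each word \<open>w\<close> to \<^term>\<open>word_star w\<close>.\<close>

definition ncpoly_star :: "('v, 'e) ncpoly \<Rightarrow> ('v, 'e) ncpoly" where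
  "ncpoly_star = Poly_Mapping.map_key word_star"

text \<open>The ideal is invariant under \<^const>\<open>ncpoly_star\<close>, so the elementwise image of the coset
  of \<open>f\<close> is the coset of \<^term>\<open>ncpoly_star f\<close>.\<close>

definition leavitt_star :: "('v, 'e) ncpoly set \<Rightarrow> ('v, 'e) ncpoly set" where
  "leavitt_star X = ncpoly_star ` X"

fun S_path :: "('v, 'e) pre_digraph \<Rightarrow> ('v, 'e) path \<Rightarrow> ('v, 'e) ncpoly set" where
  "S_path E (v, []) = P_vert E v"
| "S_path E (v, e # es) = foldl (\<lambda>a f. a \<otimes>\<^bsub>leavitt E\<^esub> S_edge E f) (S_edge E e) es"

definition P_path :: "('v, 'e) pre_digraph \<Rightarrow> ('v, 'e) path \<Rightarrow> ('v, 'e) ncpoly set" where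
  "P_path E \<mu> = S_path E \<mu> \<otimes>\<^bsub>leavitt E\<^esub> leavitt_star (S_path E \<mu>)"

text \<open>The \<open>\<int>\<close>-span of the \<open>P\<^sub>\<mu>\<close> is the additive subgroup they generate.\<close>

definition diagonal :: "('v, 'e) pre_digraph \<Rightarrow> ('v, 'e) ncpoly set set" where
  "diagonal E = generate (add_monoid (leavitt E)) (P_path E ` paths E)"

definition is_unitary :: "('v, 'e) pre_digraph \<Rightarrow> ('v, 'e) ncpoly set \<Rightarrow> bool" where
  "is_unitary E u \<longleftrightarrow> u \<in> carrier (leavitt E)
     \<and> u \<otimes>\<^bsub>leavitt E\<^esub> leavitt_star u = \<one>\<^bsub>leavitt E\<^esub>
     \<and> leavitt_star u \<otimes>\<^bsub>leavitt E\<^esub> u = \<one>\<^bsub>leavitt E\<^esub>"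


section \<open>Admissible sets and their endomorphisms\<close>

type_synonym ('v, 'e) path_pair = "('v, 'e) path \<times> ('v, 'e) path"

definition u_elem :: "('v, 'e) pre_digraph \<Rightarrow> ('v, 'e) path_pair set \<Rightarrow> ('v, 'e) ncpoly set" where
  "u_elem E J = (\<Oplus>\<^bsub>leavitt E\<^esub>p\<in>J.
     S_path E (fst p) \<otimes>\<^bsub>leavitt E\<^esub> leavitt_star (S_path E (snd p)))"

definition admissible :: "('v, 'e) pre_digraph \<Rightarrow> ('v, 'e) path_pair set \<Rightarrow> bool" where
  "admissible E J \<longleftrightarrow> finite J \<and> J \<subseteq> paths E \<times> paths E
     \<and> (\<forall>(\<mu>, \<nu>)\<in>J. path_src \<mu> = path_src \<nu> \<and> path_rng E \<mu> = path_rng E \<nu> \<and> path_length \<nu> \<ge> 1)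
     \<and> is_unitary E (u_elem E J)"

text \<open>
  The following predicate says that \<open>\<Lambda>\<close> is the unital \<open>*\<close>-endomorphism attached to \<open>J\<close>.
  The generators determine it uniquely on the carrier; as a HOL function it is
  unconstrained elsewhere.
\<close>

definition is_coding_endo ::
  "('v, 'e) pre_digraph \<Rightarrow> ('v, 'e) path_pair set
     \<Rightarrow> (('v, 'e) ncpoly set \<Rightarrow> ('v, 'e) ncpoly set) \<Rightarrow> bool" where
  "is_coding_endo E J \<Lambda> \<longleftrightarrow> \<Lambda> \<in> ring_hom (leavitt E) (leavitt E)
     \<and> (\<forall>x\<in>carrier (leavitt E). \<Lambda> (leavitt_star x) = leavitt_star (\<Lambda> x))
     \<and> (\<forall>e\<in>arcs E. \<Lambda> (S_edge E e) = u_elem E J \<otimes>\<^bsub>leavitt E\<^esub> S_edge E e)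
     \<and> (\<forall>v\<in>verts E. \<Lambda> (P_vert E v) = P_vert E v)"

definition restricts_to_diagonal_iso ::
  "('v, 'e) pre_digraph \<Rightarrow> (('v, 'e) ncpoly set \<Rightarrow> ('v, 'e) ncpoly set) \<Rightarrow> bool" where
  "restricts_to_diagonal_iso E \<Lambda> \<longleftrightarrow>
     \<Lambda> \<in> ring_iso (leavitt E\<lparr>carrier := diagonal E\<rparr>) (leavitt E\<lparr>carrier := diagonal E\<rparr>)"


section \<open>The coding graph\<close>

text \<open>For a pair written \<open>(\<mu>, e\<nu>)\<close>: the edge \<open>e\<close> and the path \<open>\<nu>\<close>.\<close>

definition lead_edge :: "('v, 'e) path_pair \<Rightarrow> 'e" where
  "lead_edge p = hd (snd (snd p))"

definition rest_path :: "('v, 'e) pre_digraph \<Rightarrow> ('v, 'e) path_pair \<Rightarrow> ('v, 'e) path" where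
  "rest_path E p = (head E (lead_edge p), tl (snd (snd p)))"

definition coding_label ::
  "('v, 'e) pre_digraph \<Rightarrow> ('v, 'e) path_pair \<times> ('v, 'e) path_pair \<Rightarrow> ('v, 'e) ncpoly set" where
  "coding_label E a =
     leavitt_star (S_path E (rest_path E (fst a))) \<otimes>\<^bsub>leavitt E\<^esub> S_path E (fst (snd a))"

definition coding_graph ::
  "('v, 'e) pre_digraph \<Rightarrow> ('v, 'e) path_pair set
     \<Rightarrow> (('v, 'e) path_pair, ('v, 'e) path_pair \<times> ('v, 'e) path_pair) pre_digraph" where
  "coding_graph E J =
     \<lparr>verts = J, arcs = {a \<in> J \<times> J. coding_label E a \<noteq> \<zero>\<^bsub>leavitt E\<^esub>}, tail = fst, head = snd\<rparr>"

text \<open>Labels \<open>P\<^sub>v\<close> are covered by the case of a path of length \<open>0\<close>.\<close>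

definition coding_degree ::
  "('v, 'e) pre_digraph \<Rightarrow> ('v, 'e) path_pair \<times> ('v, 'e) path_pair \<Rightarrow> int" where
  "coding_degree E a = (THE d. \<exists>\<alpha>\<in>paths E.
      coding_label E a = S_path E \<alpha> \<and> d = int (path_length \<alpha>)
    \<or> coding_label E a = leavitt_star (S_path E \<alpha>) \<and> d = - int (path_length \<alpha>))"

definition only_nonneg_edges :: "('v, 'e) pre_digraph \<Rightarrow> ('v, 'e) path_pair set \<Rightarrow> bool" where
  "only_nonneg_edges E J \<longleftrightarrow> (\<forall>a\<in>arcs (coding_graph E J). coding_degree E a \<ge> 0)"

definition has_nonpos_cycle :: "('v, 'e) pre_digraph \<Rightarrow> ('v, 'e) path_pair set \<Rightarrow> bool" where
  "has_nonpos_cycle E J \<longleftrightarrow>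
     (\<exists>p. wf_digraph.closed_w (coding_graph E J) p \<and> (\<forall>a\<in>set p. coding_degree E a \<le> 0))"

text \<open>
  A path with \<open>m\<close> edges visits \<open>m + 1\<close> vertices, so its code consists of \<open>m + 1\<close> edges of \<open>E\<close>.
  The code is never empty, so recording it as a list of edges loses no information.
\<close>

definition coding_word ::
  "('v, 'e) pre_digraph \<Rightarrow> ('v, 'e) path_pair set
     \<Rightarrow> (('v, 'e) path_pair, ('v, 'e) path_pair \<times> ('v, 'e) path_pair) path \<Rightarrow> 'e list" where
  "coding_word E J \<omega> =
     map lead_edge (pre_digraph.awalk_verts (coding_graph E J) (fst \<omega>) (snd \<omega>))"

definition left_synchronizing :: "('v, 'e) pre_digraph \<Rightarrow> ('v, 'e) path_pair set \<Rightarrow> bool" where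
  "left_synchronizing E J \<longleftrightarrow>
     (\<exists>m. \<forall>\<omega>1\<in>paths (coding_graph E J). \<forall>\<omega>2\<in>paths (coding_graph E J).
        path_length \<omega>1 = m \<longrightarrow> path_length \<omega>2 = m \<longrightarrow>
        coding_word E J \<omega>1 = coding_word E J \<omega>2 \<longrightarrow> path_src \<omega>1 = path_src \<omega>2)"

end

theory Submission
  imports Defs "HOL-Library.Omega_Words_Fun"
begin

text \<open>
  Let the Leavitt path algebra act on the integer functions of \<open>(x, n)\<close>, where \<open>x\<close> is an
  infinite path and the integer \<open>n\<close> records the grading. Up to a shift of \<open>n\<close>, the unitary \<open>u\<close>
  becomes composition with the map \<open>h\<close> that sends \<open>\<mu>y\<close> to \<open>e\<nu>y\<close> for \<open>(\<mu>, e\<nu>) \<in> J\<close>, and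
  \<open>\<Lambda>(P\<^sub>\<mu>)\<close> becomes multiplication by the indicator of those \<open>x\<close> whose code starts with \<open>\<mu>\<close>.
  Here the code of \<open>x\<close> consists of the first edges of \<open>h(x)\<close>, \<open>h(\<sigma>h(x))\<close>,
  \<open>h(\<sigma>h(\<sigma>h(x)))\<close>, \<open>\<dots>\<close>, where \<open>\<sigma>\<close> deletes the first edge.

  If \<open>\<Lambda>\<close> maps the diagonal onto itself, then the finitely many \<open>P\<^sub>\<mu>\<close> with \<open>(\<mu>, e\<nu>) \<in> J\<close> are
  images of elements of the diagonal, so for some \<open>m\<close> the first \<open>m\<close> letters of the code of \<open>x\<close>
  determine the pair in \<open>J\<close> whose first component is an initial segment of \<open>x\<close>.
  As the coding graph has only non-negative edges, a finite path in it can be traced backwards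
  from any infinite path that starts at the range of its last pair. This gives an infinite path
  that starts with the first component of the first pair and whose code starts with the code of
  the given path. Hence \<open>m\<close> is a delay.
\<close>

section \<open>The free ring and its involution\<close>

text \<open>Updating a coefficient outside the support amounts to adding a monomial. In this form
  the induction suits additive maps and reduces bilinear identities to monomials.\<close>

lemma ncpoly_induct [case_names zero add]:
  fixes f :: "'a \<Rightarrow>\<^sub>0 'b::ab_group_add"
  assumes zero: "P 0"
    and add: "\<And>w c f. w \<notin> Poly_Mapping.keys f \<Longrightarrow> P f \<Longrightarrow> P (Poly_Mapping.single w c + f)"
  shows "P f"
proof (induction f rule: update_induct)
  case const
  then show ?case by (rule zero)
next
  case (update f a b)
  have "Poly_Mapping.update a b f = Poly_Mapping.single a b + f"
    using update(1)
    by (intro poly_mapping_eqI) (auto simp: lookup_update lookup_add lookup_single when_def in_keys_iff)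
  then show ?case using add[OF update(1,3)] by simp
qed

lemma word_star_word_star [simp]: "word_star (word_star w) = w"
  for w :: "('v, 'e) gen free_word"
proof -
  have "gen_star (gen_star g) = g" for g :: "('v, 'e) gen" by (cases g) auto
  then show ?thesis by (cases w) (simp add: word_star_def rev_map comp_def)
qed

lemma inj_word_star: "inj word_star"
  by (metis injI word_star_word_star)

lemma word_star_plus: "word_star (v + w) = word_star w + word_star v"
  by (simp add: word_star_def plus_free_word_def)

lemma ncpoly_star_single: "ncpoly_star (Poly_Mapping.single w c) = Poly_Mapping.single (word_star w) c"
  using map_key_single[OF inj_word_star, of "word_star w" c] by (simp add: ncpoly_star_def)

lemma ncpoly_star_zero [simp]: "ncpoly_star 0 = 0"
  by (simp add: ncpoly_star_def inj_word_star)

lemma ncpoly_star_add: "ncpoly_star (f + g) = ncpoly_star f + ncpoly_star g"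
  by (simp add: ncpoly_star_def inj_word_star map_key_plus)

lemma ncpoly_star_uminus: "ncpoly_star (- f) = - ncpoly_star f"
  using ncpoly_star_add[of f "- f"] by (simp add: eq_neg_iff_add_eq_0 add.commute)

lemma ncpoly_star_diff: "ncpoly_star (f - g) = ncpoly_star f - ncpoly_star g"
  using ncpoly_star_add[of f "- g"] by (simp add: ncpoly_star_uminus)

lemma ncpoly_star_sum: "ncpoly_star (sum f A) = (\<Sum>a\<in>A. ncpoly_star (f a))"
  by (induction A rule: infinite_finite_induct) (auto simp: ncpoly_star_add)

lemma ncpoly_star_ncpoly_star [simp]: "ncpoly_star (ncpoly_star f) = f"
  by (induction f rule: ncpoly_induct) (auto simp: ncpoly_star_add ncpoly_star_single)

text \<open>Both sides are biadditive, so induction on each factor leaves two monomials. There the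
  claim is that \<open>word_star\<close> reverses concatenation, while the integer coefficients
  commute.\<close>

lemma ncpoly_star_mult: "ncpoly_star (f * g) = ncpoly_star g * ncpoly_star f"
proof (induction f rule: ncpoly_induct)
  case zero
  then show ?case by simp
next
  case (add w c f)
  have "ncpoly_star (Poly_Mapping.single w c * g) = ncpoly_star g * ncpoly_star (Poly_Mapping.single w c)"
    by (induction g rule: ncpoly_induct)
      (auto simp: ncpoly_star_add ncpoly_star_single distrib_left distrib_right mult_single
        word_star_plus mult.commute)
  with add show ?case
    by (simp add: ncpoly_star_add distrib_left distrib_right)
qed

lemma ncpoly_star_gen_poly: "ncpoly_star (gen_poly g) = gen_poly (gen_star g)"
  by (simp add: gen_poly_def ncpoly_star_single word_star_def)

lemma ncpoly_star_one [simp]: "ncpoly_star 1 = 1"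
proof -
  have "word_star 0 = 0"
    by (simp add: word_star_def zero_free_word_def)
  then show ?thesis
    by (metis ncpoly_star_single single_one)
qed

lemma free_ring_simps [simp]:
  "f \<otimes>\<^bsub>free_ring G\<^esub> g = f * g" "\<one>\<^bsub>free_ring G\<^esub> = 1" "\<zero>\<^bsub>free_ring G\<^esub> = 0"
  "f \<oplus>\<^bsub>free_ring G\<^esub> g = f + g"
  by (simp_all add: free_ring_def)

lemma free_ring_carrier:
  "f \<in> carrier (free_ring G) \<longleftrightarrow> (\<forall>w\<in>Poly_Mapping.keys f. set (letters w) \<subseteq> gens G)"
  by (simp add: free_ring_def)

lemma free_ring_closed [simp, intro]:
  shows "0 \<in> carrier (free_ring G)" "1 \<in> carrier (free_ring G)"
    and "f \<in> carrier (free_ring G) \<Longrightarrow> g \<in> carrier (free_ring G) \<Longrightarrow> f + g \<in> carrier (free_ring G)"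
    and "f \<in> carrier (free_ring G) \<Longrightarrow> g \<in> carrier (free_ring G) \<Longrightarrow> f * g \<in> carrier (free_ring G)"
    and "f \<in> carrier (free_ring G) \<Longrightarrow> - f \<in> carrier (free_ring G)"
    and "f \<in> carrier (free_ring G) \<Longrightarrow> g \<in> carrier (free_ring G) \<Longrightarrow> f - g \<in> carrier (free_ring G)"
    and "x \<in> gens G \<Longrightarrow> gen_poly x \<in> carrier (free_ring G)"
    and "f \<in> carrier (free_ring G) \<Longrightarrow> ncpoly_star f \<in> carrier (free_ring G)"
proof -
  show add: "f \<in> carrier (free_ring G) \<Longrightarrow> g \<in> carrier (free_ring G) \<Longrightarrow> f + g \<in> carrier (free_ring G)"
    for f g using keys_add[of f g] by (auto simp: free_ring_carrier)
  show uminus: "f \<in> carrier (free_ring G) \<Longrightarrow> - f \<in> carrier (free_ring G)" for f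
    by (simp add: free_ring_carrier)
  show "f \<in> carrier (free_ring G) \<Longrightarrow> g \<in> carrier (free_ring G) \<Longrightarrow> f - g \<in> carrier (free_ring G)"
    unfolding diff_conv_add_uminus by (intro add uminus)
  show "f \<in> carrier (free_ring G) \<Longrightarrow> g \<in> carrier (free_ring G) \<Longrightarrow> f * g \<in> carrier (free_ring G)"
    using keys_mult[of f g] by (fastforce simp: free_ring_carrier plus_free_word_def)
  show "ncpoly_star f \<in> carrier (free_ring G)" if f: "f \<in> carrier (free_ring G)"
    unfolding free_ring_carrier
  proof
    fix w assume "w \<in> Poly_Mapping.keys (ncpoly_star f)"
    then have "word_star w \<in> Poly_Mapping.keys f"
      by (simp add: ncpoly_star_def keys_map_key[OF inj_word_star])
    then have *: "set (letters (word_star w)) \<subseteq> gens G"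
      using f by (simp add: free_ring_carrier)
    have "gen_star x \<in> gens G \<Longrightarrow> x \<in> gens G" for x
      by (cases x) (auto simp: gens_def)
    with * show "set (letters w) \<subseteq> gens G"
      by (auto simp: word_star_def)
  qed
qed (auto simp: free_ring_carrier gen_poly_def zero_free_word_def)

lemma free_ring_closed_sum [intro]:
  "(\<And>a. a \<in> A \<Longrightarrow> f a \<in> carrier (free_ring G)) \<Longrightarrow> sum f A \<in> carrier (free_ring G)"
  by (induction A rule: infinite_finite_induct) auto

lemma ring_free_ring: "ring (free_ring G)"
proof (rule ringI)
  show "abelian_group (free_ring G)"
  proof (rule abelian_groupI)
    fix f assume "f \<in> carrier (free_ring G)"
    then show "\<exists>g\<in>carrier (free_ring G). g \<oplus>\<^bsub>free_ring G\<^esub> f = \<zero>\<^bsub>free_ring G\<^esub>"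
      by (intro bexI[of _ "- f"]) auto
  qed (auto simp: add_ac)
  show "Group.monoid (free_ring G)"
    by (rule monoidI) (auto simp: mult.assoc)
qed (auto simp: distrib_left distrib_right)

section \<open>The ideal of relations and its invariance under the involution\<close>

lemma leavitt_relations_closed: "wf_digraph G \<Longrightarrow> leavitt_relations G \<subseteq> carrier (free_ring G)"
  unfolding leavitt_relations_def
  by (auto simp: gens_def wf_digraph.head_in_verts wf_digraph.tail_in_verts
      intro!: free_ring_closed free_ring_closed_sum)

lemma leavitt_relationsI:
  "v \<in> verts G \<Longrightarrow> pV v * pV v - pV v \<in> leavitt_relations G"
  "v \<in> verts G \<Longrightarrow> w \<in> verts G \<Longrightarrow> v \<noteq> w \<Longrightarrow> pV v * pV w \<in> leavitt_relations G"
  "e \<in> arcs G \<Longrightarrow> e' \<in> arcs G \<Longrightarrow> e \<noteq> e' \<Longrightarrow> sG e * sE e' \<in> leavitt_relations G"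
  "e \<in> arcs G \<Longrightarrow> sG e * sE e - pV (head G e) \<in> leavitt_relations G"
  "e \<in> arcs G \<Longrightarrow> pV (tail G e) * sE e - sE e \<in> leavitt_relations G"
  "e \<in> arcs G \<Longrightarrow> sE e * pV (head G e) - sE e \<in> leavitt_relations G"
  "e \<in> arcs G \<Longrightarrow> sG e * pV (tail G e) - sG e \<in> leavitt_relations G"
  "e \<in> arcs G \<Longrightarrow> pV (head G e) * sG e - sG e \<in> leavitt_relations G"
  "v \<in> verts G \<Longrightarrow> pV v - (\<Sum>e\<in>out_arcs G v. sE e * sG e) \<in> leavitt_relations G"
  "(\<Sum>v\<in>verts G. pV v) - 1 \<in> leavitt_relations G"
  unfolding leavitt_relations_def by blast+

context fin_digraph
begin

lemma ideal_leavitt_ideal: "ideal (leavitt_ideal G) (free_ring G)"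
  unfolding leavitt_ideal_def
  by (rule ring.genideal_ideal[OF ring_free_ring leavitt_relations_closed]) unfold_locales

lemma relation_in_leavitt_ideal: "f \<in> leavitt_relations G \<Longrightarrow> f \<in> leavitt_ideal G"
  unfolding leavitt_ideal_def
  using ring.genideal_self[OF ring_free_ring leavitt_relations_closed[OF wf_digraph_axioms]] by blast

lemma leavitt_ideal_minimal:
  assumes "ideal I (free_ring G)" "leavitt_relations G \<subseteq> I"
  shows "leavitt_ideal G \<subseteq> I"
  unfolding leavitt_ideal_def by (rule ring.genideal_minimal[OF ring_free_ring assms])

lemma idealI_free_ring:
  assumes "I \<subseteq> carrier (free_ring G)" "0 \<in> I"
    and "\<And>f g. f \<in> I \<Longrightarrow> g \<in> I \<Longrightarrow> f + g \<in> I"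
    and "\<And>f. f \<in> I \<Longrightarrow> - f \<in> I"
    and "\<And>f g. f \<in> I \<Longrightarrow> g \<in> carrier (free_ring G) \<Longrightarrow> f * g \<in> I"
    and "\<And>f g. f \<in> I \<Longrightarrow> g \<in> carrier (free_ring G) \<Longrightarrow> g * f \<in> I"
  shows "ideal I (free_ring G)"
proof (rule idealI[OF ring_free_ring])
  interpret ring "free_ring G" by (rule ring_free_ring)
  show "subgroup I (add_monoid (free_ring G))"
  proof (rule add.subgroupI)
    show "\<ominus>\<^bsub>free_ring G\<^esub> f \<in> I" if "f \<in> I" for f
    proof -
      have "\<ominus>\<^bsub>free_ring G\<^esub> f = - f"
        using that assms by (intro minus_equality) auto
      then show ?thesis using assms(4) that by simp
    qed
  qed (use assms in auto)
qed (use assms in auto)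

text \<open>The involution sends every relation to a relation. The polynomials whose star lies in
  the ideal form an ideal themselves, and this ideal contains the relations, so minimality
  applies.\<close>

lemma leavitt_ideal_star: "f \<in> leavitt_ideal G \<Longrightarrow> ncpoly_star f \<in> leavitt_ideal G"
proof -
  let ?I = "{f \<in> carrier (free_ring G). ncpoly_star f \<in> leavitt_ideal G}"
  interpret I: ideal "leavitt_ideal G" "free_ring G" by (rule ideal_leavitt_ideal)
  have uminus: "- f \<in> leavitt_ideal G" if "f \<in> leavitt_ideal G" for f
    using I.I_l_closed[OF that, of "- 1"] by (simp add: free_ring_closed)
  have add: "f + g \<in> leavitt_ideal G" if "f \<in> leavitt_ideal G" "g \<in> leavitt_ideal G" for f g
    using additive_subgroup.a_closed[OF I.additive_subgroup_axioms that] by simp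
  have mult: "f * g \<in> leavitt_ideal G" "g * f \<in> leavitt_ideal G"
    if "f \<in> leavitt_ideal G" "g \<in> carrier (free_ring G)" for f g
    using I.I_l_closed[OF that] I.I_r_closed[OF that] by simp_all
  have 0: "0 \<in> leavitt_ideal G"
    using I.additive_subgroup_axioms additive_subgroup.zero_closed by fastforce
  have "ideal ?I (free_ring G)"
    by (rule idealI_free_ring) (simp_all add: subset_iff ncpoly_star_add ncpoly_star_uminus
        ncpoly_star_mult 0 add uminus mult)
  moreover have "ncpoly_star f \<in> leavitt_relations G" if "f \<in> leavitt_relations G" for f
    using that
    by (subst (asm) leavitt_relations_def, elim UnE CollectE exE conjE singletonE)
      (simp_all add: ncpoly_star_diff ncpoly_star_mult ncpoly_star_gen_poly ncpoly_star_sum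
        leavitt_relationsI)
  then have "leavitt_relations G \<subseteq> ?I"
    using leavitt_relations_closed[OF wf_digraph_axioms] relation_in_leavitt_ideal by blast
  ultimately have "leavitt_ideal G \<subseteq> ?I"
    by (rule leavitt_ideal_minimal)
  then show "f \<in> leavitt_ideal G \<Longrightarrow> ncpoly_star f \<in> leavitt_ideal G"
    by blast
qed

end

section \<open>The Leavitt path algebra\<close>

lemma mem_paths_iff: "(v, es) \<in> paths G \<longleftrightarrow> (\<exists>w. pre_digraph.awalk G v es w)"
  by (simp add: paths_def)

context fin_digraph
begin

lemma ring_leavitt: "ring (leavitt G)"
  unfolding leavitt_def by (rule ideal.quotient_is_ring[OF ideal_leavitt_ideal])

lemma leavitt_class_hom: "leavitt_class G \<in> ring_hom (free_ring G) (leavitt G)"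
  using ideal.rcos_ring_hom[OF ideal_leavitt_ideal] unfolding leavitt_def leavitt_class_def .

lemma leavitt_class_closed [simp, intro]:
  "f \<in> carrier (free_ring G) \<Longrightarrow> leavitt_class G f \<in> carrier (leavitt G)"
  by (rule ring_hom_closed[OF leavitt_class_hom])

lemma carrier_leavittE:
  assumes "x \<in> carrier (leavitt G)"
  obtains f where "f \<in> carrier (free_ring G)" "x = leavitt_class G f"
  using assms unfolding leavitt_def leavitt_class_def
  by (auto simp: FactRing_def A_RCOSETS_def RCOSETS_def a_r_coset_def)

lemma leavitt_class_mult:
  "f \<in> carrier (free_ring G) \<Longrightarrow> g \<in> carrier (free_ring G) \<Longrightarrow>
    leavitt_class G f \<otimes>\<^bsub>leavitt G\<^esub> leavitt_class G g = leavitt_class G (f * g)"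
  using ring_hom_mult[OF leavitt_class_hom] by simp

lemma leavitt_class_add:
  "f \<in> carrier (free_ring G) \<Longrightarrow> g \<in> carrier (free_ring G) \<Longrightarrow>
    leavitt_class G f \<oplus>\<^bsub>leavitt G\<^esub> leavitt_class G g = leavitt_class G (f + g)"
  using ring_hom_add[OF leavitt_class_hom] by simp

lemma leavitt_class_one: "\<one>\<^bsub>leavitt G\<^esub> = leavitt_class G 1"
  using ring_hom_one[OF leavitt_class_hom] by simp

lemma leavitt_class_zero: "\<zero>\<^bsub>leavitt G\<^esub> = leavitt_class G 0"
  using ring_hom_zero[OF leavitt_class_hom ring_free_ring ring_leavitt] by simp

lemma mem_leavitt_class: "g \<in> leavitt_class G f \<longleftrightarrow> g - f \<in> leavitt_ideal G"
proof -
  have "g \<in> leavitt_class G f \<longleftrightarrow> (\<exists>i\<in>leavitt_ideal G. g = i + f)"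
    by (simp add: leavitt_class_def a_r_coset_def r_coset_def)
  also have "\<dots> \<longleftrightarrow> g - f \<in> leavitt_ideal G"
    by (metis add_diff_cancel_right' diff_add_cancel)
  finally show ?thesis .
qed

lemma leavitt_class_eqI:
  assumes f: "f \<in> carrier (free_ring G)" and g: "g \<in> carrier (free_ring G)"
    and "f - g \<in> leavitt_ideal G"
  shows "leavitt_class G f = leavitt_class G g"
proof -
  interpret I: ideal "leavitt_ideal G" "free_ring G" by (rule ideal_leavitt_ideal)
  have "f \<in> leavitt_ideal G +>\<^bsub>free_ring G\<^esub> g"
    using assms mem_leavitt_class unfolding leavitt_class_def by simp
  then show ?thesis
    using I.a_repr_independence'[OF _ g] unfolding leavitt_class_def by simp
qed

lemma leavitt_class_rel: "f - g \<in> leavitt_relations G \<Longrightarrow>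
    f \<in> carrier (free_ring G) \<Longrightarrow> g \<in> carrier (free_ring G) \<Longrightarrow> leavitt_class G f = leavitt_class G g"
  by (rule leavitt_class_eqI) (auto intro: relation_in_leavitt_ideal)

text \<open>Invariance of the ideal gives one inclusion for every \<open>f\<close>. Applied to
  \<open>ncpoly_star f\<close>, it gives the other because the star is an involution.\<close>

lemma leavitt_star_class: "leavitt_star (leavitt_class G f) = leavitt_class G (ncpoly_star f)"
proof -
  have "ncpoly_star g \<in> leavitt_class G (ncpoly_star f)" if "g \<in> leavitt_class G f" for f g
    using leavitt_ideal_star[of "g - f"] that by (simp add: mem_leavitt_class ncpoly_star_diff)
  then show ?thesis
    unfolding leavitt_star_def
    by (metis (no_types, lifting) equalityI image_subset_iff ncpoly_star_ncpoly_star rev_image_eqI subsetI)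
qed

lemma leavitt_star_closed [simp, intro]:
  "x \<in> carrier (leavitt G) \<Longrightarrow> leavitt_star x \<in> carrier (leavitt G)"
  by (auto elim!: carrier_leavittE simp: leavitt_star_class)

lemma leavitt_star_star [simp]:
  "x \<in> carrier (leavitt G) \<Longrightarrow> leavitt_star (leavitt_star x) = x"
  by (auto elim!: carrier_leavittE simp: leavitt_star_class)

lemma leavitt_star_mult:
  "x \<in> carrier (leavitt G) \<Longrightarrow> y \<in> carrier (leavitt G) \<Longrightarrow>
    leavitt_star (x \<otimes>\<^bsub>leavitt G\<^esub> y) = leavitt_star y \<otimes>\<^bsub>leavitt G\<^esub> leavitt_star x"
  by (auto elim!: carrier_leavittE simp: leavitt_star_class leavitt_class_mult ncpoly_star_mult)

lemma leavitt_star_add: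
  "x \<in> carrier (leavitt G) \<Longrightarrow> y \<in> carrier (leavitt G) \<Longrightarrow>
    leavitt_star (x \<oplus>\<^bsub>leavitt G\<^esub> y) = leavitt_star x \<oplus>\<^bsub>leavitt G\<^esub> leavitt_star y"
  by (auto elim!: carrier_leavittE simp: leavitt_star_class leavitt_class_add ncpoly_star_add)

lemma leavitt_star_zero [simp]: "leavitt_star \<zero>\<^bsub>leavitt G\<^esub> = \<zero>\<^bsub>leavitt G\<^esub>"
  by (simp add: leavitt_class_zero leavitt_star_class)

section \<open>The defining relations in the quotient\<close>

lemma gens_closed [simp]:
  "v \<in> verts G \<Longrightarrow> pV v \<in> carrier (free_ring G)"
  "e \<in> arcs G \<Longrightarrow> sE e \<in> carrier (free_ring G)"
  "e \<in> arcs G \<Longrightarrow> sG e \<in> carrier (free_ring G)"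
  by (auto simp: gens_def intro: free_ring_closed)

lemma P_vert_closed [simp, intro]: "v \<in> verts G \<Longrightarrow> P_vert G v \<in> carrier (leavitt G)"
  by (simp add: P_vert_def)

lemma S_edge_closed [simp, intro]: "e \<in> arcs G \<Longrightarrow> S_edge G e \<in> carrier (leavitt G)"
  by (simp add: S_edge_def)

lemma P_vert_star [simp]: "leavitt_star (P_vert G v) = P_vert G v"
  by (simp add: P_vert_def leavitt_star_class ncpoly_star_gen_poly)

lemma S_edge_star: "leavitt_star (S_edge G e) = leavitt_class G (sG e)"
  by (simp add: S_edge_def leavitt_star_class ncpoly_star_gen_poly)

lemma P_vert_mult:
  assumes "v \<in> verts G" "w \<in> verts G"
  shows "P_vert G v \<otimes>\<^bsub>leavitt G\<^esub> P_vert G w = (if v = w then P_vert G v else \<zero>\<^bsub>leavitt G\<^esub>)"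
  using assms leavitt_relationsI(1)[of v G] leavitt_relationsI(2)[of v G w]
  by (cases "v = w")
    (simp_all add: P_vert_def leavitt_class_mult leavitt_class_zero leavitt_class_rel)

lemma P_vert_S_edge:
  assumes "e \<in> arcs G"
  shows "P_vert G (tail G e) \<otimes>\<^bsub>leavitt G\<^esub> S_edge G e = S_edge G e"
  using assms leavitt_relationsI(5)[of e G]
  by (simp add: P_vert_def S_edge_def leavitt_class_mult leavitt_class_rel)

lemma S_edge_P_vert:
  assumes "e \<in> arcs G"
  shows "S_edge G e \<otimes>\<^bsub>leavitt G\<^esub> P_vert G (head G e) = S_edge G e"
  using assms leavitt_relationsI(6)[of e G]
  by (simp add: P_vert_def S_edge_def leavitt_class_mult leavitt_class_rel)

lemma S_edge_star_S_edge:
  assumes "e \<in> arcs G" "f \<in> arcs G"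
  shows "leavitt_star (S_edge G e) \<otimes>\<^bsub>leavitt G\<^esub> S_edge G f
    = (if e = f then P_vert G (head G e) else \<zero>\<^bsub>leavitt G\<^esub>)"
  using assms leavitt_relationsI(3)[of e G f] leavitt_relationsI(4)[of e G]
  unfolding S_edge_star
  by (cases "e = f")
    (simp_all add: P_vert_def leavitt_class_zero S_edge_def leavitt_class_mult leavitt_class_rel)

section \<open>Paths and the products of their elements\<close>

lemma mem_paths_Nil [simp]: "(v, []) \<in> paths G \<longleftrightarrow> v \<in> verts G"
  by (auto simp: paths_def awalk_def)

lemma mem_paths_Cons [simp]:
  "(v, e # es) \<in> paths G \<longleftrightarrow> e \<in> arcs G \<and> v = tail G e \<and> (head G e, es) \<in> paths G"
  by (auto simp: paths_def awalk_Cons_iff)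

lemma path_rng_Nil [simp]: "path_rng G (v, []) = v"
  by (simp add: path_rng_def)

lemma path_rng_Cons [simp]: "path_rng G (v, e # es) = path_rng G (head G e, es)"
  by (simp add: path_rng_def)

lemma path_rng_in_verts: "(v, es) \<in> paths G \<Longrightarrow> path_rng G (v, es) \<in> verts G"
  by (induction es arbitrary: v) auto

text \<open>\<open>S_path\<close> is a product nested to the left. Moving a left factor out of the
  fold prepares the recursion on the first edge, on which the later inductions over paths
  rest.\<close>

lemma foldl_S_edge:
  assumes "set es \<subseteq> arcs G" "x \<in> carrier (leavitt G)" "y \<in> carrier (leavitt G)"
  shows "foldl (\<lambda>a f. a \<otimes>\<^bsub>leavitt G\<^esub> S_edge G f) (x \<otimes>\<^bsub>leavitt G\<^esub> y) es
    = x \<otimes>\<^bsub>leavitt G\<^esub> foldl (\<lambda>a f. a \<otimes>\<^bsub>leavitt G\<^esub> S_edge G f) y es"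
proof -
  interpret L: ring "leavitt G" by (rule ring_leavitt)
  show ?thesis
    using assms by (induction es arbitrary: y) (auto simp: L.m_assoc)
qed

lemma S_path_Cons:
  assumes "(v, e # es) \<in> paths G"
  shows "S_path G (v, e # es) = S_edge G e \<otimes>\<^bsub>leavitt G\<^esub> S_path G (head G e, es)"
proof (cases es)
  case Nil
  then show ?thesis using assms by (simp add: S_edge_P_vert)
next
  case (Cons f fs)
  have "set fs \<subseteq> arcs G"
    using assms Cons by (auto simp: mem_paths_iff awalk_def)
  then show ?thesis
    using assms Cons by (simp add: foldl_S_edge)
qed

lemma S_path_closed [simp, intro]: "(v, es) \<in> paths G \<Longrightarrow> S_path G (v, es) \<in> carrier (leavitt G)"
proof (induction es arbitrary: v)
  case (Cons e es)
  interpret L: ring "leavitt G" by (rule ring_leavitt)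
  from Cons show ?case
    by (simp add: S_path_Cons del: S_path.simps(2))
qed auto

lemma P_vert_S_path:
  assumes "(v, es) \<in> paths G" "w \<in> verts G"
  shows "P_vert G w \<otimes>\<^bsub>leavitt G\<^esub> S_path G (v, es) = (if w = v then S_path G (v, es) else \<zero>\<^bsub>leavitt G\<^esub>)"
proof (cases es)
  case Nil
  then show ?thesis using assms by (simp add: P_vert_mult)
next
  interpret L: ring "leavitt G" by (rule ring_leavitt)
  case (Cons e fs)
  with assms have e: "e \<in> arcs G" "v = tail G e" "(head G e, fs) \<in> paths G" by auto
  then have "S_path G (v, es) = P_vert G v \<otimes>\<^bsub>leavitt G\<^esub> S_path G (v, es)"
    using assms Cons
    by (simp add: S_path_Cons P_vert_S_edge L.m_assoc[symmetric] del: S_path.simps(2))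
  moreover have "P_vert G w \<otimes>\<^bsub>leavitt G\<^esub> (P_vert G v \<otimes>\<^bsub>leavitt G\<^esub> S_path G (v, es))
      = (if w = v then P_vert G v \<otimes>\<^bsub>leavitt G\<^esub> S_path G (v, es) else \<zero>\<^bsub>leavitt G\<^esub>)"
    using assms e by (simp add: L.m_assoc[symmetric] P_vert_mult)
  ultimately show ?thesis by simp
qed

text \<open>Equal leading edges cancel, and the first difference makes the product zero. Hence in a
  non-zero product one path continues the other. If the starred path is the longer one, the value is
  recorded as well, since its degree decides that case later.\<close>

lemma S_path_star_S_path:
  assumes "(v, bs) \<in> paths G" "(w, cs) \<in> paths G"
    and "leavitt_star (S_path G (v, bs)) \<otimes>\<^bsub>leavitt G\<^esub> S_path G (w, cs) \<noteq> \<zero>\<^bsub>leavitt G\<^esub>"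
  shows "v = w \<and> ((\<exists>as. cs = bs @ as) \<or>
    (\<exists>as. bs = cs @ as \<and> (path_rng G (w, cs), as) \<in> paths G \<and>
      leavitt_star (S_path G (v, bs)) \<otimes>\<^bsub>leavitt G\<^esub> S_path G (w, cs)
        = leavitt_star (S_path G (path_rng G (w, cs), as))))"
  using assms
proof (induction bs arbitrary: v w cs)
  case Nil
  then show ?case by (auto simp: P_vert_S_path split: if_splits)
next
  interpret L: ring "leavitt G" by (rule ring_leavitt)
  case (Cons b bs)
  note [simp del] = S_path.simps(2)
  show ?case
  proof (cases cs)
    case Nil
    have "leavitt_star (S_path G (v, b # bs)) \<otimes>\<^bsub>leavitt G\<^esub> P_vert G w
        = leavitt_star (P_vert G w \<otimes>\<^bsub>leavitt G\<^esub> S_path G (v, b # bs))"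
      using Cons.prems Nil by (subst leavitt_star_mult) auto
    also have "\<dots> = (if w = v then leavitt_star (S_path G (v, b # bs)) else \<zero>\<^bsub>leavitt G\<^esub>)"
      using Cons.prems(1,2) Nil by (subst P_vert_S_path) auto
    finally show ?thesis using Cons.prems Nil by (auto split: if_splits)
  next
    case cs: (Cons c ds)
    have b: "b \<in> arcs G" "v = tail G b" "(head G b, bs) \<in> paths G"
      and c: "c \<in> arcs G" "w = tail G c" "(head G c, ds) \<in> paths G"
      using Cons.prems cs by auto
    let ?B = "S_path G (head G b, bs)" and ?C = "S_path G (head G c, ds)"
    have "leavitt_star (S_path G (v, b # bs)) \<otimes>\<^bsub>leavitt G\<^esub> S_path G (w, c # ds)
      = leavitt_star ?B \<otimes>\<^bsub>leavitt G\<^esub>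
        ((leavitt_star (S_edge G b) \<otimes>\<^bsub>leavitt G\<^esub> S_edge G c) \<otimes>\<^bsub>leavitt G\<^esub> ?C)"
      using b c by (simp add: S_path_Cons leavitt_star_mult L.m_assoc)
    also have "\<dots> = (if b = c then leavitt_star ?B \<otimes>\<^bsub>leavitt G\<^esub> ?C else \<zero>\<^bsub>leavitt G\<^esub>)"
      using b c by (simp add: S_edge_star_S_edge P_vert_S_path)
    finally have eq: "leavitt_star (S_path G (v, b # bs)) \<otimes>\<^bsub>leavitt G\<^esub> S_path G (w, c # ds)
      = (if b = c then leavitt_star ?B \<otimes>\<^bsub>leavitt G\<^esub> ?C else \<zero>\<^bsub>leavitt G\<^esub>)" .
    with Cons.prems(3) cs have [simp]: "b = c"
      and "leavitt_star ?B \<otimes>\<^bsub>leavitt G\<^esub> ?C \<noteq> \<zero>\<^bsub>leavitt G\<^esub>"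
      by (auto split: if_splits)
    from Cons.IH[OF b(3) c(3) this(2)] show ?thesis
      using eq b c cs by auto
  qed
qed

end

section \<open>A graded representation on functions of infinite paths\<close>

definition inf_paths :: "('v, 'e) pre_digraph \<Rightarrow> 'e word set" where
  "inf_paths G = {x. \<forall>n. x n \<in> arcs G \<and> head G (x n) = tail G (x (Suc n))}"

text \<open>The operators are defined on all sequences of edges, but the Leavitt relations hold only
  at points of \<open>inf_paths\<close>. The test in the \<open>Ghost\<close> case ensures that
  prepending \<open>e\<close> to an infinite path again gives one.\<close>

fun gen_op :: "('v, 'e) pre_digraph \<Rightarrow> ('v, 'e) gen \<Rightarrow> ('e word \<Rightarrow> int \<Rightarrow> int) \<Rightarrow> 'e word \<Rightarrow> int \<Rightarrow> int" where
  "gen_op G (Vert v) g x n = (if tail G (x 0) = v then g x n else 0)"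
| "gen_op G (Edge e) g x n = (if x 0 = e then g (suffix 1 x) (n + 1) else 0)"
| "gen_op G (Ghost e) g x n = (if tail G (x 0) = head G e then g (e ## x) (n - 1) else 0)"

definition word_op ::
  "('v, 'e) pre_digraph \<Rightarrow> ('v, 'e) gen free_word \<Rightarrow> ('e word \<Rightarrow> int \<Rightarrow> int) \<Rightarrow> 'e word \<Rightarrow> int \<Rightarrow> int" where
  "word_op G w g = foldr (gen_op G) (letters w) g"

definition ncpoly_op ::
  "('v, 'e) pre_digraph \<Rightarrow> ('v, 'e) ncpoly \<Rightarrow> ('e word \<Rightarrow> int \<Rightarrow> int) \<Rightarrow> 'e word \<Rightarrow> int \<Rightarrow> int" where
  "ncpoly_op G f g x n = (\<Sum>w\<in>Poly_Mapping.keys f. Poly_Mapping.lookup f w * word_op G w g x n)"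

text \<open>A coset acts through a chosen representative. At infinite paths the choice does not
  matter, because elements of the ideal act as zero there.\<close>

definition leavitt_op ::
  "('v, 'e) pre_digraph \<Rightarrow> ('v, 'e) ncpoly set \<Rightarrow> ('e word \<Rightarrow> int \<Rightarrow> int) \<Rightarrow> 'e word \<Rightarrow> int \<Rightarrow> int" where
  "leavitt_op G A = ncpoly_op G (SOME f. f \<in> A)"

lemma inf_pathsD:
  assumes "x \<in> inf_paths G"
  shows "x n \<in> arcs G" "head G (x n) = tail G (x (Suc n))"
  using assms by (auto simp: inf_paths_def)

lemma suffix_inf_paths [simp, intro]: "x \<in> inf_paths G \<Longrightarrow> suffix k x \<in> inf_paths G"
  by (auto simp: inf_paths_def)

lemma build_inf_paths [simp]:
  "(e ## x) \<in> inf_paths G \<longleftrightarrow> e \<in> arcs G \<and> head G e = tail G (x 0) \<and> x \<in> inf_paths G" (is "?L \<longleftrightarrow> ?R")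
proof
  assume *: ?L
  have "x n \<in> arcs G \<and> head G (x n) = tail G (x (Suc n))" for n
    using inf_pathsD[OF *, of "Suc n"] by simp
  with inf_pathsD[OF *, of 0] show ?R by (simp add: inf_paths_def)
next
  assume ?R
  then have "(e ## x) n \<in> arcs G \<and> head G ((e ## x) n) = tail G ((e ## x) (Suc n))" for n
    by (cases n) (auto simp: inf_paths_def)
  then show ?L by (simp add: inf_paths_def)
qed

section \<open>The action of the free ring by linear operators\<close>

lemma word_op_zero: "word_op G w (\<lambda>_ _. 0) = (\<lambda>_ _. 0)"
proof -
  have "gen_op G a (\<lambda>_ _. 0) = (\<lambda>_ _. 0)" for a
    by (cases a) (auto simp: fun_eq_iff)
  then have "foldr (gen_op G) as (\<lambda>_ _. 0) = (\<lambda>_ _. 0)" for as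
    by (induction as) auto
  then show ?thesis by (simp add: word_op_def)
qed

lemma word_op_add: "word_op G w (\<lambda>x n. g x n + h x n) = (\<lambda>x n. word_op G w g x n + word_op G w h x n)"
proof -
  have "gen_op G a (\<lambda>x n. g x n + h x n) = (\<lambda>x n. gen_op G a g x n + gen_op G a h x n)" for a g h
    by (cases a) (auto simp: fun_eq_iff)
  then have "foldr (gen_op G) as (\<lambda>x n. g x n + h x n)
      = (\<lambda>x n. foldr (gen_op G) as g x n + foldr (gen_op G) as h x n)" for as
    by (induction as) auto
  then show ?thesis by (simp add: word_op_def)
qed

lemma word_op_scale: "word_op G w (\<lambda>x n. c * g x n) = (\<lambda>x n. c * word_op G w g x n)"
proof -
  have "gen_op G a (\<lambda>x n. c * g x n) = (\<lambda>x n. c * gen_op G a g x n)" for a g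
    by (cases a) (auto simp: fun_eq_iff)
  then have "foldr (gen_op G) as (\<lambda>x n. c * g x n) = (\<lambda>x n. c * foldr (gen_op G) as g x n)" for as
    by (induction as) auto
  then show ?thesis by (simp add: word_op_def)
qed

lemma word_op_plus: "word_op G (v + w) g = word_op G v (word_op G w g)"
  by (simp add: word_op_def plus_free_word_def)

lemma ncpoly_op_superset:
  assumes "finite A" "Poly_Mapping.keys f \<subseteq> A"
  shows "ncpoly_op G f g x n = (\<Sum>w\<in>A. Poly_Mapping.lookup f w * word_op G w g x n)"
  unfolding ncpoly_op_def
  by (rule sum.mono_neutral_left) (use assms in \<open>auto simp: in_keys_iff\<close>)

lemma ncpoly_op_zero [simp]: "ncpoly_op G 0 g x n = 0"
  by (simp add: ncpoly_op_def)

lemma ncpoly_op_single: "ncpoly_op G (Poly_Mapping.single w c) g x n = c * word_op G w g x n"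
  using ncpoly_op_superset[of "{w}" "Poly_Mapping.single w c"] by simp

lemma ncpoly_op_one [simp]: "ncpoly_op G 1 g x n = g x n"
proof -
  have "ncpoly_op G (Poly_Mapping.single 0 1) g x n = g x n"
    by (subst ncpoly_op_single) (simp add: word_op_def zero_free_word_def)
  then show ?thesis by (metis single_one)
qed

lemma ncpoly_op_gen_poly: "ncpoly_op G (gen_poly a) g x n = gen_op G a g x n"
  unfolding gen_poly_def by (subst ncpoly_op_single) (simp add: word_op_def)

lemma ncpoly_op_add: "ncpoly_op G (f + h) g x n = ncpoly_op G f g x n + ncpoly_op G h g x n"
proof -
  let ?A = "Poly_Mapping.keys f \<union> Poly_Mapping.keys h"
  have "ncpoly_op G (f + h) g x n
      = (\<Sum>w\<in>?A. Poly_Mapping.lookup (f + h) w * word_op G w g x n)"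
    by (rule ncpoly_op_superset) (use keys_add[of f h] in auto)
  also have "\<dots> = (\<Sum>w\<in>?A. Poly_Mapping.lookup f w * word_op G w g x n)
      + (\<Sum>w\<in>?A. Poly_Mapping.lookup h w * word_op G w g x n)"
    by (simp add: lookup_add distrib_right sum.distrib)
  also have "\<dots> = ncpoly_op G f g x n + ncpoly_op G h g x n"
    by (subst (1 2) ncpoly_op_superset[of ?A]) auto
  finally show ?thesis .
qed

lemma ncpoly_op_uminus: "ncpoly_op G (- f) g x n = - ncpoly_op G f g x n"
  using ncpoly_op_add[of G f "- f" g x n] by simp

lemma ncpoly_op_diff: "ncpoly_op G (f - h) g x n = ncpoly_op G f g x n - ncpoly_op G h g x n"
  using ncpoly_op_add[of G "f - h" h g x n] by simp

lemma ncpoly_op_sum: "ncpoly_op G (sum F A) g x n = (\<Sum>a\<in>A. ncpoly_op G (F a) g x n)"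
  by (induction A rule: infinite_finite_induct) (auto simp: ncpoly_op_add)

text \<open>Induction on both factors leaves two monomials, whose product acts by composition. The
  inner induction rests on the linearity of \<open>word_op\<close> in the function acted on.\<close>

lemma ncpoly_op_mult: "ncpoly_op G (f * h) g x n = ncpoly_op G f (ncpoly_op G h g) x n"
proof (induction f rule: ncpoly_induct)
  case zero
  then show ?case by simp
next
  case (add w c f)
  have "ncpoly_op G (Poly_Mapping.single w c * h) g x n = c * word_op G w (ncpoly_op G h g) x n"
  proof (induction h rule: ncpoly_induct)
    case zero
    then show ?case by (simp add: word_op_zero)
  next
    case (add v d h)
    have "ncpoly_op G (Poly_Mapping.single v d + h) g
        = (\<lambda>x n. d * word_op G v g x n + ncpoly_op G h g x n)"
      by (simp add: fun_eq_iff ncpoly_op_add ncpoly_op_single)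
    then show ?case
      using add
      by (simp add: word_op_add word_op_scale distrib_left ncpoly_op_add mult_single
          ncpoly_op_single word_op_plus)
  qed
  then show ?case
    using add by (simp add: distrib_right ncpoly_op_add ncpoly_op_single)
qed

section \<open>Passage of the action to the Leavitt path algebra\<close>

context fin_digraph
begin

text \<open>The generators evaluate their argument only at infinite paths when started at one. So an
  identity known just on \<open>inf_paths\<close> may be used underneath another operator.\<close>

lemma ncpoly_op_cong:
  assumes "f \<in> carrier (free_ring G)" and "\<And>x n. x \<in> inf_paths G \<Longrightarrow> g x n = h x n"
    and "x \<in> inf_paths G"
  shows "ncpoly_op G f g x n = ncpoly_op G f h x n"
proof -
  have gen: "gen_op G a g x n = gen_op G a h x n"
    if "a \<in> gens G" "x \<in> inf_paths G" "\<And>x n. x \<in> inf_paths G \<Longrightarrow> g x n = h x n" for a g h x n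
    using that by (cases a) (auto simp: gens_def)
  have "set as \<subseteq> gens G \<Longrightarrow> x \<in> inf_paths G \<Longrightarrow>
      foldr (gen_op G) as g x n = foldr (gen_op G) as h x n" for as x n
  proof (induction as arbitrary: x n)
    case Nil
    then show ?case using assms(2) by simp
  next
    case (Cons a as)
    then show ?case by (simp, intro gen) auto
  qed
  then have "word_op G w g x n = word_op G w h x n" if "w \<in> Poly_Mapping.keys f" for w
    using assms that by (auto simp: word_op_def free_ring_carrier)
  then show ?thesis by (simp add: ncpoly_op_def)
qed

lemma leavitt_relations_op:
  assumes x: "x \<in> inf_paths G" and f: "f \<in> leavitt_relations G"
  shows "ncpoly_op G f g x n = 0"
proof -
  have x0: "x 0 \<in> arcs G" "tail G (x (Suc 0)) = head G (x 0)"
    using inf_pathsD[OF x, of 0] by auto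
  then have "tail G (x 0) \<in> verts G" by simp
  note ops = ncpoly_op_diff ncpoly_op_mult ncpoly_op_gen_poly ncpoly_op_sum
  have suffix: "suffix (Suc 0) (e ## y) = y" for e and y :: "'b word"
    by (rule ext) simp
  \<comment> \<open>This is the operator of \<open>S_e S_e^*\<close>: deleting the first edge and
    prepending it again restores both the path and the integer.\<close>
  have ghost: "(if x 0 = e then ncpoly_op G (sG e) g (suffix 1 x) (n + 1) else 0)
      = (if x 0 = e then g x n else 0)" for e
    using x0 by (auto simp: ncpoly_op_gen_poly)
  \<comment> \<open>Only the first edge of \<open>x\<close> contributes, and it occurs in the sum
    exactly when it leaves \<open>v\<close>.\<close>
  have out: "(\<Sum>e\<in>out_arcs G v. if x 0 = e then g x n else 0) = (if tail G (x 0) = v then g x n else 0)" for v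
    using x0 finite_out_arcs[of v] by (simp add: sum.delta')
  show ?thesis
    using f x0(2)
    by (subst (asm) leavitt_relations_def, elim UnE CollectE exE conjE singletonE)
      (auto simp: ops ghost out x0 suffix)
qed

text \<open>The polynomials that act as zero at all infinite paths form an ideal containing the
  relations, so minimality applies.\<close>

lemma leavitt_ideal_op:
  assumes "f \<in> leavitt_ideal G" "x \<in> inf_paths G"
  shows "ncpoly_op G f g x n = 0"
proof -
  let ?K = "{f \<in> carrier (free_ring G). \<forall>g. \<forall>x\<in>inf_paths G. \<forall>n. ncpoly_op G f g x n = 0}"
  have zero: "ncpoly_op G f (\<lambda>_ _. 0) x n = 0" for f x n
    by (simp add: ncpoly_op_def word_op_zero)
  have "ideal ?K (free_ring G)"
  proof (rule idealI_free_ring)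
    show "h * f \<in> ?K" if "f \<in> ?K" "h \<in> carrier (free_ring G)" for f h
    proof -
      \<comment> \<open>The inner function vanishes on \<open>inf_paths\<close> but perhaps not
        elsewhere, so it is first replaced by the zero function.\<close>
      have "ncpoly_op G h (ncpoly_op G f g) x n = 0" if "x \<in> inf_paths G" for g x n
        using ncpoly_op_cong[OF \<open>h \<in> _\<close> _ that, of "ncpoly_op G f g" "\<lambda>_ _. 0"] \<open>f \<in> ?K\<close>
        by (simp add: zero)
      then show ?thesis using that by (simp add: ncpoly_op_mult)
    qed
  qed (auto simp: ncpoly_op_add ncpoly_op_uminus ncpoly_op_mult intro: free_ring_closed)
  moreover have "leavitt_relations G \<subseteq> ?K"
    using leavitt_relations_closed[OF wf_digraph_axioms] leavitt_relations_op by blast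
  ultimately have "leavitt_ideal G \<subseteq> ?K"
    by (rule leavitt_ideal_minimal)
  then show ?thesis using assms by blast
qed

lemma leavitt_op_class:
  assumes "x \<in> inf_paths G"
  shows "leavitt_op G (leavitt_class G f) g x n = ncpoly_op G f g x n"
proof -
  interpret I: ideal "leavitt_ideal G" "free_ring G" by (rule ideal_leavitt_ideal)
  have "0 \<in> leavitt_ideal G"
    using I.additive_subgroup_axioms additive_subgroup.zero_closed by fastforce
  then have "f \<in> leavitt_class G f"
    by (simp add: mem_leavitt_class)
  then have "(SOME h. h \<in> leavitt_class G f) \<in> leavitt_class G f"
    by (rule someI)
  then have "(SOME h. h \<in> leavitt_class G f) - f \<in> leavitt_ideal G"
    by (simp only: mem_leavitt_class)
  from leavitt_ideal_op[OF this assms, of g n] show ?thesis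
    by (simp add: leavitt_op_def ncpoly_op_diff)
qed

lemma leavitt_op_mult:
  assumes "A \<in> carrier (leavitt G)" "B \<in> carrier (leavitt G)" "x \<in> inf_paths G"
  shows "leavitt_op G (A \<otimes>\<^bsub>leavitt G\<^esub> B) g x n = leavitt_op G A (leavitt_op G B g) x n"
proof -
  obtain a b where a: "a \<in> carrier (free_ring G)" "A = leavitt_class G a"
    and b: "b \<in> carrier (free_ring G)" "B = leavitt_class G b"
    using assms(1,2) by (metis carrier_leavittE)
  have "ncpoly_op G a (ncpoly_op G b g) x n = ncpoly_op G a (leavitt_op G B g) x n"
    by (rule ncpoly_op_cong) (use a b assms in \<open>simp_all add: leavitt_op_class\<close>)
  then show ?thesis
    using a b assms by (simp add: leavitt_class_mult leavitt_op_class ncpoly_op_mult)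
qed

lemma leavitt_op_add:
  assumes "A \<in> carrier (leavitt G)" "B \<in> carrier (leavitt G)" "x \<in> inf_paths G"
  shows "leavitt_op G (A \<oplus>\<^bsub>leavitt G\<^esub> B) g x n = leavitt_op G A g x n + leavitt_op G B g x n"
  using assms
  by (auto elim!: carrier_leavittE simp: leavitt_class_add leavitt_op_class ncpoly_op_add)

lemma leavitt_op_zero [simp]:
  "x \<in> inf_paths G \<Longrightarrow> leavitt_op G \<zero>\<^bsub>leavitt G\<^esub> g x n = 0"
  by (simp add: leavitt_class_zero leavitt_op_class)

lemma leavitt_op_one [simp]:
  "x \<in> inf_paths G \<Longrightarrow> leavitt_op G \<one>\<^bsub>leavitt G\<^esub> g x n = g x n"
  by (simp add: leavitt_class_one leavitt_op_class)

lemma leavitt_op_finsum: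
  assumes "finite I" "F \<in> I \<rightarrow> carrier (leavitt G)" "x \<in> inf_paths G"
  shows "leavitt_op G (\<Oplus>\<^bsub>leavitt G\<^esub>i\<in>I. F i) g x n = (\<Sum>i\<in>I. leavitt_op G (F i) g x n)"
proof -
  interpret L: ring "leavitt G" by (rule ring_leavitt)
  show ?thesis using assms
    by (induction I rule: finite_induct) (auto simp: L.finsum_insert leavitt_op_add)
qed

section \<open>Testing, removing and prepending initial segments of infinite paths\<close>

lemma leavitt_op_P_vert: "x \<in> inf_paths G \<Longrightarrow>
    leavitt_op G (P_vert G v) g x n = (if tail G (x 0) = v then g x n else 0)"
  by (simp add: P_vert_def leavitt_op_class ncpoly_op_gen_poly)

lemma leavitt_op_S_edge: "x \<in> inf_paths G \<Longrightarrow>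
    leavitt_op G (S_edge G e) g x n = (if x 0 = e then g (suffix 1 x) (n + 1) else 0)"
  by (simp add: S_edge_def leavitt_op_class ncpoly_op_gen_poly)

lemma leavitt_op_S_edge_star: "x \<in> inf_paths G \<Longrightarrow>
    leavitt_op G (leavitt_star (S_edge G e)) g x n
      = (if tail G (x 0) = head G e then g (e ## x) (n - 1) else 0)"
  by (simp add: S_edge_star leavitt_op_class ncpoly_op_gen_poly)

text \<open>The condition on the source carries all the information when the path is a vertex, whose
  list of edges is empty.\<close>

definition starts_with :: "'b word \<Rightarrow> 'a \<times> 'b list \<Rightarrow> bool" where
  "starts_with x \<mu> \<longleftrightarrow> tail G (x 0) = fst \<mu> \<and> prefix (length (snd \<mu>)) x = snd \<mu>"

lemma starts_with_Nil [simp]: "starts_with x (v, []) \<longleftrightarrow> tail G (x 0) = v"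
  by (simp add: starts_with_def)

lemma starts_with_Cons:
  assumes "x \<in> inf_paths G"
  shows "starts_with x (v, e # es) \<longleftrightarrow> tail G (x 0) = v \<and> x 0 = e \<and> starts_with (suffix 1 x) (head G e, es)"
proof -
  have "prefix (Suc k) x = x 0 # prefix k (suffix 1 x)" for k
    by (induction k) auto
  then show ?thesis
    using inf_pathsD(2)[OF assms, of 0] by (auto simp: starts_with_def)
qed

lemma path_conc:
  assumes "(v, es) \<in> paths G" "x \<in> inf_paths G" "tail G (x 0) = path_rng G (v, es)"
  shows "es \<frown> x \<in> inf_paths G" "tail G ((es \<frown> x) 0) = v" "starts_with (es \<frown> x) (v, es)"
proof -
  show *: "es \<frown> x \<in> inf_paths G" "tail G ((es \<frown> x) 0) = v"
    using assms(1,3)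
    by (induction es arbitrary: v) (use assms(2) in auto)
  then show "starts_with (es \<frown> x) (v, es)"
    by (simp add: starts_with_def)
qed

lemma starts_withE:
  assumes "starts_with x (v, es)" "x \<in> inf_paths G" "(v, es) \<in> paths G"
  obtains y where "x = es \<frown> y" "y = suffix (length es) x" "y \<in> inf_paths G"
    "tail G (y 0) = path_rng G (v, es)"
proof
  let ?y = "suffix (length es) x"
  show "x = es \<frown> ?y"
    using assms(1) prefix_suffix[of x "length es"] by (simp add: starts_with_def)
  show "tail G (?y 0) = path_rng G (v, es)"
    using assms
  proof (induction es arbitrary: v x)
    case (Cons e es)
    from Cons.prems have "starts_with (suffix 1 x) (head G e, es)"
      by (simp add: starts_with_Cons)
    from Cons.IH[OF this suffix_inf_paths[OF Cons.prems(2)]] Cons.prems(3) show ?case by simp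
  qed simp
qed (use assms in auto)

lemma leavitt_op_S_path:
  assumes "(v, es) \<in> paths G" "x \<in> inf_paths G"
  shows "leavitt_op G (S_path G (v, es)) g x n
    = (if starts_with x (v, es) then g (suffix (length es) x) (n + int (length es)) else 0)"
  using assms
proof (induction es arbitrary: v x n)
  case Nil
  then show ?case by (simp add: leavitt_op_P_vert)
next
  case (Cons e es)
  then have e: "e \<in> arcs G" "(head G e, es) \<in> paths G" "v = tail G e" by auto
  have "leavitt_op G (S_path G (v, e # es)) g x n
    = (if x 0 = e then leavitt_op G (S_path G (head G e, es)) g (suffix 1 x) (n + 1) else 0)"
    using e Cons.prems
    by (simp add: S_path_Cons leavitt_op_mult leavitt_op_S_edge del: S_path.simps(2))
  also have "leavitt_op G (S_path G (head G e, es)) g (suffix 1 x) (n + 1)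
      = (if starts_with (suffix 1 x) (head G e, es)
        then g (suffix (length es) (suffix 1 x)) (n + 1 + int (length es)) else 0)"
    by (rule Cons.IH[OF e(2)], rule suffix_inf_paths, rule Cons.prems)
  also have "(if x 0 = e then \<dots> else 0) = (if starts_with x (v, e # es)
      then g (suffix (length (e # es)) x) (n + int (length (e # es))) else 0)"
    using Cons.prems e by (auto simp: starts_with_Cons algebra_simps)
  finally show ?case .
qed

lemma leavitt_op_S_path_star:
  assumes "(v, es) \<in> paths G" "x \<in> inf_paths G"
  shows "leavitt_op G (leavitt_star (S_path G (v, es))) g x n
    = (if tail G (x 0) = path_rng G (v, es) then g (es \<frown> x) (n - int (length es)) else 0)"
  using assms
proof (induction es arbitrary: v x n g)
  case Nil
  then show ?case by (simp add: leavitt_op_P_vert)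
next
  case (Cons e es)
  then have e: "e \<in> arcs G" "(head G e, es) \<in> paths G" "v = tail G e" by auto
  then have "leavitt_op G (leavitt_star (S_path G (v, e # es))) g x n
    = leavitt_op G (leavitt_star (S_path G (head G e, es))) (leavitt_op G (leavitt_star (S_edge G e)) g) x n"
    using Cons.prems by (simp add: S_path_Cons leavitt_op_mult leavitt_star_mult del: S_path.simps(2))
  also have "\<dots> = (if tail G (x 0) = path_rng G (head G e, es)
      then leavitt_op G (leavitt_star (S_edge G e)) g (es \<frown> x) (n - int (length es)) else 0)"
    by (rule Cons.IH[OF e(2) Cons.prems(2)])
  also have "\<dots> = (if tail G (x 0) = path_rng G (v, e # es)
      then g ((e # es) \<frown> x) (n - int (length (e # es))) else 0)"
    using path_conc[OF e(2) Cons.prems(2)] by (simp add: leavitt_op_S_edge_star algebra_simps)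
  finally show ?case .
qed

end

section \<open>Coding endomorphisms on infinite paths\<close>

context fin_digraph
begin

lemma leavitt_star_finsum:
  assumes "finite I" "F \<in> I \<rightarrow> carrier (leavitt G)"
  shows "leavitt_star (\<Oplus>\<^bsub>leavitt G\<^esub>i\<in>I. F i) = (\<Oplus>\<^bsub>leavitt G\<^esub>i\<in>I. leavitt_star (F i))"
proof -
  interpret L: ring "leavitt G" by (rule ring_leavitt)
  show ?thesis using assms
  proof (induction I rule: finite_induct)
    case (insert i I)
    have "F \<in> I \<rightarrow> carrier (leavitt G)" "F i \<in> carrier (leavitt G)"
      "(\<lambda>i. leavitt_star (F i)) \<in> I \<rightarrow> carrier (leavitt G)"
      using insert.prems by auto
    then show ?case
      using insert by (simp add: L.finsum_insert leavitt_star_add L.finsum_closed)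
  qed simp
qed

lemma S_path_closed' [simp, intro]: "\<mu> \<in> paths G \<Longrightarrow> S_path G \<mu> \<in> carrier (leavitt G)"
  using S_path_closed by (cases \<mu>) blast

text \<open>The first factor tests for the initial segment \<mu> and removes it, the second prepends
  \<nu>. Since the ranges agree, the second test is always passed.\<close>

lemma leavitt_op_S_path_S_path_star:
  assumes "\<mu> \<in> paths G" "\<nu> \<in> paths G" "path_rng G \<mu> = path_rng G \<nu>" "x \<in> inf_paths G"
  shows "leavitt_op G (S_path G \<mu> \<otimes>\<^bsub>leavitt G\<^esub> leavitt_star (S_path G \<nu>)) g x n
    = (if starts_with x \<mu> then g (snd \<nu> \<frown> suffix (path_length \<mu>) x)
        (n + int (path_length \<mu>) - int (path_length \<nu>)) else 0)"
proof -
  obtain v es w fs where [simp]: "\<mu> = (v, es)" "\<nu> = (w, fs)" by (cases \<mu>, cases \<nu>)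
  have "leavitt_op G (leavitt_star (S_path G (w, fs))) g (suffix (length es) x) (n + int (length es))
      = g (fs \<frown> suffix (length es) x) (n + int (length es) - int (length fs))"
    if sw: "starts_with x (v, es)"
  proof -
    from sw assms obtain y where y: "y = suffix (length es) x" "y \<in> inf_paths G"
      "tail G (y 0) = path_rng G (v, es)"
      by (auto elim: starts_withE)
    then have "tail G (y 0) = path_rng G (w, fs)" using assms by simp
    then have "leavitt_op G (leavitt_star (S_path G (w, fs))) g y (n + int (length es))
      = g (fs \<frown> y) (n + int (length es) - int (length fs))"
      using leavitt_op_S_path_star[of w fs y] assms y(2) by auto
    then show ?thesis unfolding y(1) .
  qed
  then show ?thesis
    using assms by (simp add: leavitt_op_mult leavitt_op_S_path path_length_def)
qed

lemma leavitt_op_P_path: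
  assumes "\<mu> \<in> paths G" "x \<in> inf_paths G"
  shows "leavitt_op G (P_path G \<mu>) g x n = (if starts_with x \<mu> then g x n else 0)"
proof -
  have "snd \<mu> \<frown> suffix (path_length \<mu>) x = x" if "starts_with x \<mu>"
    using that prefix_suffix[of x "length (snd \<mu>)"] by (simp add: starts_with_def path_length_def)
  then show ?thesis
    unfolding P_path_def using assms by (simp add: leavitt_op_S_path_S_path_star)
qed

lemma P_path_closed [simp, intro]: "\<mu> \<in> paths G \<Longrightarrow> P_path G \<mu> \<in> carrier (leavitt G)"
  unfolding P_path_def
  by (intro monoid.m_closed[OF ring.is_monoid[OF ring_leavitt]] leavitt_star_closed S_path_closed')

lemma P_path_Cons:
  assumes "(v, e # es) \<in> paths G"
  shows "P_path G (v, e # es) = S_edge G e \<otimes>\<^bsub>leavitt G\<^esub>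
    (P_path G (head G e, es) \<otimes>\<^bsub>leavitt G\<^esub> leavitt_star (S_edge G e))"
proof -
  interpret L: ring "leavitt G" by (rule ring_leavitt)
  show ?thesis
    using assms by (simp add: P_path_def S_path_Cons leavitt_star_mult L.m_assoc del: S_path.simps(2))
qed

text \<open>Without sinks the edges can be chosen one after another; the guard \<open>n = 0\<close>
  fixes the source of the first one only.\<close>

lemma exists_inf_path:
  assumes "no_sinks G" "v \<in> verts G"
  obtains x where "x \<in> inf_paths G" "tail G (x 0) = v"
proof -
  have out: "\<exists>e. e \<in> arcs G \<and> tail G e = w" if "w \<in> verts G" for w
    using assms(1) that by (fastforce simp: no_sinks_def out_arcs_def)
  have "\<exists>x. \<forall>n. (x n \<in> arcs G \<and> (n = 0 \<longrightarrow> tail G (x n) = v)) \<and> head G (x n) = tail G (x (Suc n))"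
  proof (rule dependent_nat_choice)
    show "\<exists>e. e \<in> arcs G \<and> (0 = 0 \<longrightarrow> tail G e = v)"
      using out[OF assms(2)] by simp
    show "\<exists>f. (f \<in> arcs G \<and> (Suc n = 0 \<longrightarrow> tail G f = v)) \<and> head G e = tail G f"
      if "e \<in> arcs G \<and> (n = 0 \<longrightarrow> tail G e = v)" for e n
      using out[of "head G e"] that by (metis head_in_verts nat.simps(3))
  qed
  then show thesis using that by (auto simp: inf_paths_def)
qed

lemma starts_with_append:
  assumes "starts_with x (v, es @ fs)"
  shows "starts_with x (v, es)"
proof -
  have "take (length es) (prefix (length (es @ fs)) x) = es"
    using assms by (simp add: starts_with_def)
  then show ?thesis
    using assms by (simp add: starts_with_def subsequence_take)
qed

end

locale coding_endo = fin_digraph G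
  for G :: "('v, 'e) pre_digraph" +
  fixes J :: "('v, 'e) path_pair set"
    and \<Lambda> :: "('v, 'e) ncpoly set \<Rightarrow> ('v, 'e) ncpoly set"
  assumes no_sinks: "no_sinks G"
    and admissible: "admissible G J"
    and coding_endo: "is_coding_endo G J \<Lambda>"
begin

section \<open>The unitary as a map on infinite paths\<close>

lemma finite_J: "finite J"
  using admissible by (simp add: admissible_def)

lemma J_paths:
  assumes "p \<in> J"
  shows "fst p \<in> paths G" "snd p \<in> paths G" "fst (fst p) = fst (snd p)"
    "path_rng G (fst p) = path_rng G (snd p)" "snd (snd p) \<noteq> []"
  using assms admissible by (force simp: admissible_def path_src_def path_length_def)+

lemma u_closed [simp]: "u_elem G J \<in> carrier (leavitt G)"
  and u_unitary: "u_elem G J \<otimes>\<^bsub>leavitt G\<^esub> leavitt_star (u_elem G J) = \<one>\<^bsub>leavitt G\<^esub>"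
  using admissible by (auto simp: admissible_def is_unitary_def)

text \<open>At this stage it is not known how many pairs fit \<open>x\<close>, so each pair keeps
  its own summand.\<close>

lemma leavitt_op_u_sum:
  assumes "x \<in> inf_paths G"
  shows "leavitt_op G (u_elem G J) g x n = (\<Sum>p\<in>J. if starts_with x (fst p)
      then g (snd (snd p) \<frown> suffix (path_length (fst p)) x)
        (n + int (path_length (fst p)) - int (path_length (snd p))) else 0)"
proof -
  interpret L: ring "leavitt G" by (rule ring_leavitt)
  show ?thesis
    unfolding u_elem_def using assms finite_J J_paths
    by (subst leavitt_op_finsum) (auto simp: leavitt_op_S_path_S_path_star)
qed

lemma leavitt_op_u_star_sum:
  assumes "x \<in> inf_paths G"
  shows "leavitt_op G (leavitt_star (u_elem G J)) g x n = (\<Sum>p\<in>J. if starts_with x (snd p)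
      then g (snd (fst p) \<frown> suffix (path_length (snd p)) x)
        (n + int (path_length (snd p)) - int (path_length (fst p))) else 0)"
proof -
  interpret L: ring "leavitt G" by (rule ring_leavitt)
  have "leavitt_star (u_elem G J)
    = (\<Oplus>\<^bsub>leavitt G\<^esub>p\<in>J. leavitt_star (S_path G (fst p) \<otimes>\<^bsub>leavitt G\<^esub> leavitt_star (S_path G (snd p))))"
    unfolding u_elem_def using finite_J J_paths by (intro leavitt_star_finsum) auto
  also have "\<dots> = (\<Oplus>\<^bsub>leavitt G\<^esub>p\<in>J. S_path G (snd p) \<otimes>\<^bsub>leavitt G\<^esub> leavitt_star (S_path G (fst p)))"
    using J_paths by (intro L.finsum_cong') (auto simp: leavitt_star_mult)
  finally show ?thesis
    using assms finite_J J_paths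
    by (simp, subst leavitt_op_finsum) (auto simp: leavitt_op_S_path_S_path_star)
qed

lemma conc_snd_starts_with:
  assumes "p \<in> J" "x \<in> inf_paths G" "starts_with x (fst p)"
  shows "snd (snd p) \<frown> suffix (path_length (fst p)) x \<in> inf_paths G"
    "starts_with (snd (snd p) \<frown> suffix (path_length (fst p)) x) (snd p)"
proof -
  obtain v es w fs where p: "p = ((v, es), (w, fs))" by (metis surj_pair)
  obtain y where "y = suffix (length es) x" "y \<in> inf_paths G" "tail G (y 0) = path_rng G (v, es)"
    using assms J_paths[OF assms(1)] p by (auto elim: starts_withE)
  then show "snd (snd p) \<frown> suffix (path_length (fst p)) x \<in> inf_paths G"
    "starts_with (snd (snd p) \<frown> suffix (path_length (fst p)) x) (snd p)"
    using path_conc[of w fs y] J_paths[OF assms(1)] p by (auto simp: path_length_def)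
qed

text \<open>Applying \<open>u u\<^sup>* = 1\<close> to the constant function \<open>1\<close> counts, with multiplicity at least one,
  the pairs whose first component is an initial segment of \<open>x\<close>.\<close>

lemma unique_pair:
  assumes x: "x \<in> inf_paths G"
  shows "\<exists>!p. p \<in> J \<and> starts_with x (fst p)"
proof -
  define A where "A = {p \<in> J. starts_with x (fst p)}"
  define y where "y p = snd (snd p) \<frown> suffix (path_length (fst p)) x" for p :: "('v, 'e) path_pair"
  \<comment> \<open>The pair \<open>p\<close> sends \<open>x\<close> at level 0 to
    \<open>y p\<close> at the level inserted here. The value counts the pairs whose second component
    starts \<open>y p\<close>, and \<open>p\<close> itself is among them.\<close>
  define m where "m p = leavitt_op G (leavitt_star (u_elem G J)) (\<lambda>_ _. 1) (y p)
      (int (path_length (fst p)) - int (path_length (snd p)))" for p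
  have fin: "finite A" using finite_J by (simp add: A_def)
  have m: "m p \<ge> 1" if "p \<in> A" for p
  proof -
    have p: "p \<in> J" "starts_with x (fst p)" using that by (auto simp: A_def)
    have "m p = (\<Sum>q\<in>J. if starts_with (y p) (snd q) then 1 else 0)"
      using conc_snd_starts_with(1)[OF p(1) x p(2)]
      by (simp add: m_def y_def leavitt_op_u_star_sum)
    also have "\<dots> \<ge> (\<Sum>q\<in>{p}. if starts_with (y p) (snd q) then 1 else 0)"
      by (rule sum_mono2) (use finite_J p in auto)
    finally show ?thesis
      using conc_snd_starts_with(2)[OF p(1) x p(2)] by (simp add: y_def)
  qed
  have "1 = leavitt_op G (u_elem G J) (leavitt_op G (leavitt_star (u_elem G J)) (\<lambda>_ _. 1)) x 0"
    using leavitt_op_one[OF x, of "\<lambda>_ _. 1" 0]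
    unfolding u_unitary[symmetric] by (simp add: leavitt_op_mult x)
  also have "\<dots> = (\<Sum>p\<in>J. if starts_with x (fst p) then m p else 0)"
    unfolding leavitt_op_u_sum[OF x] m_def y_def by (rule sum.cong) auto
  also have "\<dots> = (\<Sum>p\<in>A. m p)"
    unfolding A_def using finite_J by (simp add: sum.inter_filter)
  finally have sum: "(\<Sum>p\<in>A. m p) = 1" by simp
  \<comment> \<open>The total is 1 and every term is at least 1, so two pairs are too many; with
    none the total would be 0.\<close>
  have "(\<Sum>p\<in>A. 1) \<le> (\<Sum>p\<in>A. m p)"
    by (rule sum_mono) (rule m)
  then have "card A \<le> 1" using sum by simp
  moreover have "A \<noteq> {}" using sum by auto
  then have "card A > 0" using fin by (simp add: card_gt_0_iff)
  ultimately have "card A = 1" by linarith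
  then obtain p where "A = {p}" by (rule card_1_singletonE)
  then have "q \<in> J \<and> starts_with x (fst q) \<longleftrightarrow> q = p" for q
    unfolding A_def by blast
  then show ?thesis by (intro ex1I[of _ p]) blast+
qed

definition pair_of :: "'e word \<Rightarrow> ('v, 'e) path_pair" where
  "pair_of x = (THE p. p \<in> J \<and> starts_with x (fst p))"

lemma pair_of:
  assumes "x \<in> inf_paths G"
  shows "pair_of x \<in> J" "starts_with x (fst (pair_of x))"
  using theI'[OF unique_pair[OF assms]] by (simp_all add: pair_of_def)

lemma pair_of_eqI:
  assumes "x \<in> inf_paths G" "p \<in> J" "starts_with x (fst p)"
  shows "pair_of x = p"
  using unique_pair[OF assms(1)] pair_of[OF assms(1)] assms by blast

text \<open>In the notation of the overview, \<open>swap\<close> is the map h, and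
  \<open>step\<close> below is h followed by \<sigma>.\<close>

definition swap :: "'e word \<Rightarrow> 'e word" where
  "swap x = snd (snd (pair_of x)) \<frown> suffix (path_length (fst (pair_of x))) x"

definition swap_degree :: "'e word \<Rightarrow> int" where
  "swap_degree x = int (path_length (fst (pair_of x))) - int (path_length (snd (pair_of x)))"

lemma leavitt_op_u:
  assumes "x \<in> inf_paths G"
  shows "leavitt_op G (u_elem G J) g x n = g (swap x) (n + swap_degree x)"
proof -
  have "starts_with x (fst p) \<longleftrightarrow> p = pair_of x" if "p \<in> J" for p
    using pair_of(2)[OF assms] pair_of_eqI[OF assms that] by metis
  then have "leavitt_op G (u_elem G J) g x n = (\<Sum>p\<in>J. if p = pair_of x
      then g (swap x) (n + swap_degree x) else 0)"
    unfolding leavitt_op_u_sum[OF assms]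
    by (intro sum.cong refl if_cong) (simp_all add: swap_def swap_degree_def add_diff_eq)
  then show ?thesis
    using pair_of(1)[OF assms] finite_J by simp
qed

lemma swap_inf_paths [simp, intro]: "x \<in> inf_paths G \<Longrightarrow> swap x \<in> inf_paths G"
  unfolding swap_def using pair_of by (intro conc_snd_starts_with)

text \<open>Reading \<open>u u^* = 1\<close> at \<open>x\<close> shows that the adjoint undoes
  \<open>swap\<close>. In this way no uniqueness statement about second components has to be
  proved.\<close>

lemma leavitt_op_u_star_swap:
  assumes "x \<in> inf_paths G"
  shows "leavitt_op G (leavitt_star (u_elem G J)) g (swap x) (n + swap_degree x) = g x n"
  using leavitt_op_one[OF assms, of g n]
  unfolding u_unitary[symmetric] by (simp add: leavitt_op_mult leavitt_op_u assms)

lemma swap_0: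
  assumes "x \<in> inf_paths G"
  shows "swap x 0 = lead_edge (pair_of x)" "tail G (swap x 0) = tail G (x 0)"
proof -
  note p = pair_of[OF assms]
  show "swap x 0 = lead_edge (pair_of x)"
    using J_paths(5)[OF p(1)] by (simp add: swap_def lead_edge_def hd_conv_nth)
  show "tail G (swap x 0) = tail G (x 0)"
    using conc_snd_starts_with(2)[OF p(1) assms p(2)] p(2) J_paths(3)[OF p(1)]
    unfolding swap_def starts_with_def by simp
qed

section \<open>Codes of infinite paths and the images of the diagonal projections\<close>

definition step :: "'e word \<Rightarrow> 'e word" where
  "step x = suffix 1 (swap x)"

lemma step_inf_paths [simp, intro]: "x \<in> inf_paths G \<Longrightarrow> step x \<in> inf_paths G"
  by (simp add: step_def)

text \<open>The code of \<open>x\<close> is its image under the map on infinite paths dual to \<open>\<Lambda>\<close>.\<close>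

fun coded :: "'e word \<Rightarrow> 'e list \<Rightarrow> bool" where
  "coded x [] \<longleftrightarrow> True"
| "coded x (e # es) \<longleftrightarrow> lead_edge (pair_of x) = e \<and> coded (step x) es"

lemma coding_hom: "\<Lambda> \<in> ring_hom (leavitt G) (leavitt G)"
  using coding_endo by (simp add: is_coding_endo_def)

lemmas coding_closed [simp, intro] = ring_hom_closed[OF coding_hom]
lemmas coding_mult = ring_hom_mult[OF coding_hom]

lemma coding_star: "x \<in> carrier (leavitt G) \<Longrightarrow> \<Lambda> (leavitt_star x) = leavitt_star (\<Lambda> x)"
  and coding_S_edge: "e \<in> arcs G \<Longrightarrow> \<Lambda> (S_edge G e) = u_elem G J \<otimes>\<^bsub>leavitt G\<^esub> S_edge G e"
  and coding_P_vert: "v \<in> verts G \<Longrightarrow> \<Lambda> (P_vert G v) = P_vert G v"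
  using coding_endo by (simp_all add: is_coding_endo_def)

text \<open>The image of the projection of \<open>e # es\<close> is
  \<open>u S_e Q S_e^* u^*\<close>, where \<open>Q\<close> is the image of the projection of
  \<open>es\<close>. The left factors test the first letter of the code and move to
  \<open>step x\<close>, \<open>Q\<close> tests the remaining letters there, and the right factors
  lead back to \<open>x\<close> and to the original level.\<close>

lemma leavitt_op_coding_P_path:
  assumes "(v, es) \<in> paths G" "x \<in> inf_paths G"
  shows "leavitt_op G (\<Lambda> (P_path G (v, es))) g x n
    = (if tail G (x 0) = v \<and> coded x es then g x n else 0)"
  using assms
proof (induction es arbitrary: v x n g)
  case Nil
  then have "P_path G (v, []) = P_vert G v"
    by (simp add: P_path_def P_vert_mult)
  with Nil show ?case by (simp add: coding_P_vert leavitt_op_P_vert)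
next
  interpret L: ring "leavitt G" by (rule ring_leavitt)
  case (Cons e es)
  then have e: "e \<in> arcs G" "(head G e, es) \<in> paths G" "v = tail G e" by auto
  note x = Cons.prems(2)
  let ?u = "u_elem G J" and ?S = "S_edge G e" and ?P = "P_path G (head G e, es)"
  \<comment> \<open>The induction hypothesis is applied to this function instead of
    \<open>g\<close>, which is why the induction generalizes over \<open>g\<close>.\<close>
  let ?g = "leavitt_op G (leavitt_star ?S \<otimes>\<^bsub>leavitt G\<^esub> leavitt_star ?u) g"
  have "\<Lambda> (P_path G (v, e # es)) = ?u \<otimes>\<^bsub>leavitt G\<^esub> (?S \<otimes>\<^bsub>leavitt G\<^esub>
      (\<Lambda> ?P \<otimes>\<^bsub>leavitt G\<^esub> (leavitt_star ?S \<otimes>\<^bsub>leavitt G\<^esub> leavitt_star ?u)))"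
    using e Cons.prems
    by (simp add: P_path_Cons coding_mult coding_star coding_S_edge leavitt_star_mult L.m_assoc)
  then have "leavitt_op G (\<Lambda> (P_path G (v, e # es))) g x n
      = leavitt_op G (?S \<otimes>\<^bsub>leavitt G\<^esub>
      (\<Lambda> ?P \<otimes>\<^bsub>leavitt G\<^esub> (leavitt_star ?S \<otimes>\<^bsub>leavitt G\<^esub> leavitt_star ?u))) g (swap x) (n + swap_degree x)"
    using e x by (simp add: leavitt_op_mult leavitt_op_u)
  also have "\<dots> = (if swap x 0 = e then leavitt_op G (\<Lambda> ?P) ?g (step x) (n + swap_degree x + 1) else 0)"
    using e x by (simp add: leavitt_op_mult leavitt_op_S_edge step_def)
  also have "leavitt_op G (\<Lambda> ?P) ?g (step x) (n + swap_degree x + 1)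
      = (if tail G (step x 0) = head G e \<and> coded (step x) es
          then ?g (step x) (n + swap_degree x + 1) else 0)"
    by (rule Cons.IH[OF e(2)]) (rule step_inf_paths, rule x)
  also have "(if swap x 0 = e then (if tail G (step x 0) = head G e \<and> coded (step x) es
          then ?g (step x) (n + swap_degree x + 1) else 0) else 0)
      = (if swap x 0 = e \<and> tail G (step x 0) = head G e \<and> coded (step x) es then g x n else 0)"
  proof -
    have "?g (step x) (n + swap_degree x + 1) = g x n"
      if "swap x 0 = e" "tail G (step x 0) = head G e"
    proof -
      have "e ## step x = swap x"
        unfolding that(1)[symmetric] step_def by simp
      then show ?thesis
        using e(1) x that leavitt_op_u_star_swap[OF x, of g n]
        by (simp add: leavitt_op_mult leavitt_op_S_edge_star)
    qed
    then show ?thesis by (cases "swap x 0 = e"; cases "tail G (step x 0) = head G e") simp_all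
  qed
  also have "swap x 0 = e \<and> tail G (step x 0) = head G e \<and> coded (step x) es
      \<longleftrightarrow> tail G (x 0) = v \<and> coded x (e # es)"
  proof -
    have "tail G (step x 0) = head G (swap x 0)"
      using inf_pathsD(2)[OF swap_inf_paths[OF x], of 0] by (simp add: step_def)
    then show ?thesis
      using swap_0[OF x] e(3) by (metis coded.simps(2))
  qed
  finally show ?case .
qed

end

section \<open>Orbits in the coding graph\<close>

context fin_digraph
begin

lemma P_path_in_diagonal: "\<mu> \<in> paths G \<Longrightarrow> P_path G \<mu> \<in> diagonal G"
  unfolding diagonal_def by (rule generate.incl) simp

text \<open>The grading makes the \<open>THE\<close> in \<^const>\<open>coding_degree\<close> well defined: \<open>S\<^sub>\<alpha>\<close> shifts the
  integer coordinate by \<open>|\<alpha>|\<close>, and \<open>S\<^sub>\<beta>\<^sup>*\<close> shifts it by \<open>-|\<beta>|\<close>.\<close>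

lemma S_path_star_degree:
  assumes "no_sinks G" "\<beta> \<in> paths G" "\<alpha> \<in> paths G"
  shows "leavitt_star (S_path G \<beta>) = S_path G \<alpha> \<Longrightarrow> int (path_length \<alpha>) = - int (path_length \<beta>)"
    and "leavitt_star (S_path G \<beta>) = leavitt_star (S_path G \<alpha>) \<Longrightarrow> path_length \<alpha> = path_length \<beta>"
proof -
  obtain v bs w as where [simp]: "\<beta> = (v, bs)" "\<alpha> = (w, as)" by (cases \<alpha>, cases \<beta>)
  obtain x where x: "x \<in> inf_paths G" "tail G (x 0) = path_rng G \<beta>"
    using exists_inf_path[OF assms(1), of "path_rng G \<beta>"] path_rng_in_verts[of v bs] assms(2) by auto
  \<comment> \<open>The indicator of the level that the adjoint for \<beta> reaches from level 0.
    Another expression of the same element must shift the level equally, or its value at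
    \<open>x\<close> would be 0.\<close>
  define g where "g = (\<lambda>(_ :: 'b word) n. if n = - int (path_length \<beta>) then 1 else (0 :: int))"
  have *: "leavitt_op G (leavitt_star (S_path G \<beta>)) g x 0 = 1"
    using assms x by (simp add: leavitt_op_S_path_star g_def path_length_def)
  show "int (path_length \<alpha>) = - int (path_length \<beta>)"
    if "leavitt_star (S_path G \<beta>) = S_path G \<alpha>"
    using * unfolding that
    using assms x by (simp add: leavitt_op_S_path g_def path_length_def split: if_splits)
  show "path_length \<alpha> = path_length \<beta>"
    if "leavitt_star (S_path G \<beta>) = leavitt_star (S_path G \<alpha>)"
    using * unfolding that
    using assms x by (simp add: leavitt_op_S_path_star g_def path_length_def split: if_splits)
qed

text \<open>If the label is also some \<open>S_path\<close> without star, then both path lengths are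
  0, so the two alternatives in the definition still give the same integer.\<close>

lemma coding_degree_S_path_star:
  assumes "no_sinks G" "\<beta> \<in> paths G" "coding_label G a = leavitt_star (S_path G \<beta>)"
  shows "coding_degree G a = - int (path_length \<beta>)"
  unfolding coding_degree_def
proof (rule the_equality)
  fix d
  assume "\<exists>\<alpha>\<in>paths G. coding_label G a = S_path G \<alpha> \<and> d = int (path_length \<alpha>)
    \<or> coding_label G a = leavitt_star (S_path G \<alpha>) \<and> d = - int (path_length \<alpha>)"
  then obtain \<alpha> where "\<alpha> \<in> paths G"
    "coding_label G a = S_path G \<alpha> \<and> d = int (path_length \<alpha>)
    \<or> coding_label G a = leavitt_star (S_path G \<alpha>) \<and> d = - int (path_length \<alpha>)"
    by blast
  then show "d = - int (path_length \<beta>)"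
    using S_path_star_degree[OF assms(1,2)] assms(3) by metis
qed (use assms in blast)

end

section \<open>Realizing walks of the coding graph by infinite paths\<close>

context coding_endo
begin

lemma rest_path:
  assumes "p \<in> J"
  shows "rest_path G p \<in> paths G" "path_rng G (rest_path G p) = path_rng G (fst p)"
    "tail G (lead_edge p) = fst (fst p)" "snd (snd p) = lead_edge p # snd (rest_path G p)"
proof -
  obtain \<mu> v e es where p: "p = (\<mu>, (v, e # es))"
    using J_paths(5)[OF assms] by (metis list.exhaust prod.exhaust_sel)
  show "rest_path G p \<in> paths G" "path_rng G (rest_path G p) = path_rng G (fst p)"
    "tail G (lead_edge p) = fst (fst p)" "snd (snd p) = lead_edge p # snd (rest_path G p)"
    using J_paths[OF assms] p by (auto simp: rest_path_def lead_edge_def)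
qed

text \<open>A non-zero label makes the rest of the first pair and the leading path of the second
  comparable. An excess \<open>as\<close> of the rest would give degree \<open>- length as\<close>,
  so by non-negativity it is empty.\<close>

lemma coding_arc_extends:
  assumes "only_nonneg_edges G J" "a \<in> arcs (coding_graph G J)"
  obtains as where "fst (snd a) = (fst (rest_path G (fst a)), snd (rest_path G (fst a)) @ as)"
proof -
  obtain p q where pq: "a = (p, q)" by (cases a)
  with assms(2) have a: "a = (p, q)" "p \<in> J" "q \<in> J"
    and label: "coding_label G a \<noteq> \<zero>\<^bsub>leavitt G\<^esub>"
    by (simp_all add: coding_graph_def)
  obtain v bs w cs where eqs: "rest_path G p = (v, bs)" "fst q = (w, cs)" by (metis surj_pair)
  have paths: "(v, bs) \<in> paths G" "(w, cs) \<in> paths G"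
    using rest_path(1)[OF a(2)] J_paths(1)[OF a(3)] eqs by simp_all
  have label_eq: "coding_label G a = leavitt_star (S_path G (v, bs)) \<otimes>\<^bsub>leavitt G\<^esub> S_path G (w, cs)"
    using a eqs by (simp add: coding_label_def)
  from S_path_star_S_path[OF paths] label
  consider as where "v = w" "cs = bs @ as"
    | as where "v = w" "bs = cs @ as" "(path_rng G (w, cs), as) \<in> paths G"
      "coding_label G a = leavitt_star (S_path G (path_rng G (w, cs), as))"
    unfolding label_eq by metis
  then show thesis
  proof cases
    case 1
    then show thesis using that eqs a by simp
  next
    case 2
    have "coding_degree G a = - int (length as)"
      using coding_degree_S_path_star[OF no_sinks 2(3,4)] by (simp add: path_length_def)
    moreover have "coding_degree G a \<ge> 0"
      using assms by (simp add: only_nonneg_edges_def)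
    ultimately have "as = []" by simp
    then show thesis using that eqs a 2 by simp
  qed
qed

text \<open>Induction on the walk, backwards from its last pair. A path \<open>z\<close> for the
  remaining walk starts with the rest \<nu> of the first pair; exchanging \<nu> for \<mu> gives a
  path that \<open>step\<close> sends to \<open>z\<close>.\<close>

lemma exists_coded:
  assumes "only_nonneg_edges G J" "pre_digraph.awalk (coding_graph G J) p as q"
  shows "\<exists>x\<in>inf_paths G. starts_with x (fst p) \<and> coded x (coding_word G J (p, as))"
  using assms(2)
proof (induction as arbitrary: p)
  case Nil
  then have p: "p \<in> J"
    by (simp add: pre_digraph.awalk_def coding_graph_def)
  obtain v es where \<mu>: "fst p = (v, es)" by (metis surj_pair)
  note path = J_paths(1)[OF p, unfolded \<mu>]
  \<comment> \<open>Any infinite path from the range of the last pair can serve as the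
    continuation.\<close>
  obtain y where y: "y \<in> inf_paths G" "tail G (y 0) = path_rng G (v, es)"
    using exists_inf_path[OF no_sinks path_rng_in_verts[OF path]] by blast
  note x = path_conc[OF path y]
  then have "pair_of (es \<frown> y) = p"
    using pair_of_eqI[OF x(1) p] \<mu> by simp
  then show ?case
    using x \<mu> by (auto simp: coding_word_def pre_digraph.awalk_verts.simps)
next
  case (Cons a as)
  then have a: "a \<in> arcs (coding_graph G J)" "fst a = p" "p \<in> J" "snd a \<in> J"
    and as: "pre_digraph.awalk (coding_graph G J) (snd a) as q"
    by (auto simp: pre_digraph.awalk_def pre_digraph.cas.simps coding_graph_def)
  from Cons.IH[OF as] obtain z where z: "z \<in> inf_paths G" "starts_with z (fst (snd a))"
    "coded z (coding_word G J (snd a, as))"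
    by blast
  obtain v bs where rest: "rest_path G p = (v, bs)" by (metis surj_pair)
  note path = rest_path(1)[OF a(3), unfolded rest]
  obtain w es where \<mu>: "fst p = (w, es)" by (metis surj_pair)
  obtain cs where "fst (snd a) = (v, bs @ cs)"
    using coding_arc_extends[OF assms(1) a(1)] a(2) rest by auto
  then have "starts_with z (v, bs)"
    using z(2) starts_with_append by metis
  then obtain y where y: "z = bs \<frown> y" "y \<in> inf_paths G" "tail G (y 0) = path_rng G (v, bs)"
    using z(1) path by (auto elim: starts_withE)
  have "tail G (y 0) = path_rng G (w, es)"
    using y(3) rest_path(2)[OF a(3)] rest \<mu> by simp
  note x = path_conc[OF J_paths(1)[OF a(3), unfolded \<mu>] y(2) this]
  have p: "pair_of (es \<frown> y) = p"
    using pair_of_eqI[OF x(1) a(3)] x(3) \<mu> by simp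
  \<comment> \<open>\<open>swap\<close> replaces \<mu> by \<open>e\<close> followed by \<nu>, and
    \<nu> followed by \<open>y\<close> is \<open>z\<close>.\<close>
  have "swap (es \<frown> y) = lead_edge p ## z"
    unfolding swap_def p rest_path(4)[OF a(3)] by (simp add: \<mu> rest y(1) path_length_def)
  then have "step (es \<frown> y) = z"
    unfolding step_def by (simp add: fun_eq_iff)
  moreover have "coding_word G J (p, a # as) = lead_edge p # coding_word G J (snd a, as)"
    using a(2) by (simp add: coding_word_def pre_digraph.awalk_verts.simps coding_graph_def)
  ultimately show ?case
    using x \<mu> p z(3) by (intro bexI[of _ "es \<frown> y"]) auto
qed

section \<open>Finite dependence on the code\<close>

definition code_agree :: "nat \<Rightarrow> 'e word \<Rightarrow> 'e word \<Rightarrow> bool" where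
  "code_agree m x y \<longleftrightarrow> x \<in> inf_paths G \<and> y \<in> inf_paths G \<and> tail G (x 0) = tail G (y 0)
    \<and> (\<forall>es. length es \<le> m \<longrightarrow> coded x es = coded y es)"

lemma code_agree_mono: "code_agree m x y \<Longrightarrow> k \<le> m \<Longrightarrow> code_agree k x y"
  by (auto simp: code_agree_def)

text \<open>The words coded by a path, up to the length of \<open>w\<close>, are exactly the initial
  segments of \<open>w\<close>. The condition on sources in \<open>code_agree\<close>, which serves
  to control vertex projections already at length 0, follows from the first letter of
  \<open>w\<close>.\<close>

lemma code_agreeI:
  assumes "x \<in> inf_paths G" "y \<in> inf_paths G" "coded x w" "coded y w" "w \<noteq> []"
  shows "code_agree (length w) x y"
proof -
  have take: "coded x es \<longleftrightarrow> es = take (length es) w" if "coded x w" "length es \<le> length w" for x es w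
    using that
  proof (induction es arbitrary: x w)
    case (Cons e es)
    then show ?case by (cases w) auto
  qed simp
  have "tail G (x 0) = tail G (hd w)" if "x \<in> inf_paths G" "coded x w" for x
    using that swap_0[OF that(1)] assms(5) by (cases w) auto
  then show ?thesis
    using assms take unfolding code_agree_def by metis
qed

text \<open>For a generator the length of its path is a bound, additive inverses keep the bound, and
  sums take the maximum. The constant function 1 turns the image of a projection into the indicator
  of a set of paths.\<close>

lemma coding_diagonal_code_agree:
  assumes "A \<in> diagonal G"
  shows "A \<in> carrier (leavitt G) \<and> (\<exists>m. \<forall>x y. code_agree m x y \<longrightarrow>
    leavitt_op G (\<Lambda> A) (\<lambda>_ _. 1) x 0 = leavitt_op G (\<Lambda> A) (\<lambda>_ _. 1) y 0)"
  using assms unfolding diagonal_def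
proof (induction rule: generate.induct)
  interpret L: ring "leavitt G" by (rule ring_leavitt)
  have zero: "\<Lambda> \<zero>\<^bsub>leavitt G\<^esub> = \<zero>\<^bsub>leavitt G\<^esub>"
    by (rule ring_hom_zero[OF coding_hom ring_leavitt ring_leavitt])
  have path: "\<exists>m. \<forall>x y. code_agree m x y \<longrightarrow>
      leavitt_op G (\<Lambda> A) (\<lambda>_ _. 1) x 0 = leavitt_op G (\<Lambda> A) (\<lambda>_ _. 1) y 0"
    "A \<in> carrier (leavitt G)" if A: "A \<in> P_path G ` paths G" for A
  proof -
    from A obtain v es where es: "(v, es) \<in> paths G" "A = P_path G (v, es)" by auto
    then show "\<exists>m. \<forall>x y. code_agree m x y \<longrightarrow>
      leavitt_op G (\<Lambda> A) (\<lambda>_ _. 1) x 0 = leavitt_op G (\<Lambda> A) (\<lambda>_ _. 1) y 0"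
      by (intro exI[of _ "length es"]) (auto simp: code_agree_def leavitt_op_coding_P_path)
    show "A \<in> carrier (leavitt G)" using es by simp
  qed
  {
    case one
    show ?case by (auto simp: zero code_agree_def)
  next
    case (incl A)
    then show ?case using path by blast
  next
    case (inv A)
    note A = path[OF inv]
    \<comment> \<open>The inverses in \<open>generate\<close> are additive ones; their action is
      read off from \<open>A\<close> plus its negative being zero.\<close>
    have neg: "leavitt_op G (\<Lambda> (\<ominus>\<^bsub>leavitt G\<^esub> A)) g x n = - leavitt_op G (\<Lambda> A) g x n"
      if "x \<in> inf_paths G" for g x n
    proof -
      have "leavitt_op G (\<Lambda> (A \<oplus>\<^bsub>leavitt G\<^esub> \<ominus>\<^bsub>leavitt G\<^esub> A)) g x n
          = leavitt_op G (\<Lambda> A) g x n + leavitt_op G (\<Lambda> (\<ominus>\<^bsub>leavitt G\<^esub> A)) g x n"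
        using A that by (simp add: ring_hom_add[OF coding_hom] leavitt_op_add del: L.r_neg)
      then show ?thesis using A that by (simp add: L.r_neg zero)
    qed
    from A show ?case
      unfolding a_inv_def[symmetric] by (simp add: neg code_agree_def)
  next
    case (eng A B)
    then obtain m k where
      m: "\<And>x y. code_agree m x y \<Longrightarrow>
        leavitt_op G (\<Lambda> A) (\<lambda>_ _. 1) x 0 = leavitt_op G (\<Lambda> A) (\<lambda>_ _. 1) y 0" and
      k: "\<And>x y. code_agree k x y \<Longrightarrow>
        leavitt_op G (\<Lambda> B) (\<lambda>_ _. 1) x 0 = leavitt_op G (\<Lambda> B) (\<lambda>_ _. 1) y 0"
      by blast
    have AB: "A \<in> carrier (leavitt G)" "B \<in> carrier (leavitt G)" using eng by auto
    have "leavitt_op G (\<Lambda> (A \<oplus>\<^bsub>leavitt G\<^esub> B)) (\<lambda>_ _. 1) x 0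
        = leavitt_op G (\<Lambda> (A \<oplus>\<^bsub>leavitt G\<^esub> B)) (\<lambda>_ _. 1) y 0"
      if agree: "code_agree (max m k) x y" for x y
    proof -
      have "x \<in> inf_paths G" "y \<in> inf_paths G" using agree by (auto simp: code_agree_def)
      then show ?thesis
        using AB m[OF code_agree_mono[OF agree]] k[OF code_agree_mono[OF agree]]
        by (simp add: ring_hom_add[OF coding_hom] leavitt_op_add)
    qed
    then show ?case using AB by auto
  }
qed

section \<open>From surjectivity on the diagonal to a delay\<close>

lemma left_synchronizing_of_diagonal_iso:
  assumes nonneg: "only_nonneg_edges G J" and iso: "restricts_to_diagonal_iso G \<Lambda>"
  shows "left_synchronizing G J"
proof -
  have image: "\<Lambda> ` diagonal G = diagonal G"
    using iso by (auto simp: restricts_to_diagonal_iso_def ring_iso_def bij_betw_def)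
  have "\<exists>m. \<forall>x y. code_agree m x y \<longrightarrow> starts_with x (fst p) = starts_with y (fst p)" if "p \<in> J" for p
  proof -
    have path: "fst p \<in> paths G" by (rule J_paths(1)[OF that])
    then have "P_path G (fst p) \<in> \<Lambda> ` diagonal G"
      unfolding image by (rule P_path_in_diagonal)
    then obtain A where "A \<in> diagonal G" "P_path G (fst p) = \<Lambda> A" by blast
    with coding_diagonal_code_agree[of A] obtain m where
      m: "\<And>x y. code_agree m x y \<Longrightarrow>
        leavitt_op G (P_path G (fst p)) (\<lambda>_ _. 1) x 0 = leavitt_op G (P_path G (fst p)) (\<lambda>_ _. 1) y 0"
      by auto
    have "starts_with x (fst p) = starts_with y (fst p)" if agree: "code_agree m x y" for x y
    proof -
      have "x \<in> inf_paths G" "y \<in> inf_paths G" using agree by (auto simp: code_agree_def)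
      then show ?thesis
        using m[OF agree] path by (simp add: leavitt_op_P_path split: if_splits)
    qed
    then show ?thesis by blast
  qed
  then obtain d where
    d: "\<And>p x y. p \<in> J \<Longrightarrow> code_agree (d p) x y \<Longrightarrow> starts_with x (fst p) = starts_with y (fst p)"
    by metis
  \<comment> \<open>The sum is a convenient common upper bound for the finitely many
    \<open>d p\<close>.\<close>
  define m where "m = sum d J"
  have "path_src \<omega>1 = path_src \<omega>2"
    if \<omega>: "\<omega>1 \<in> paths (coding_graph G J)" "\<omega>2 \<in> paths (coding_graph G J)"
      and len: "path_length \<omega>1 = m" "path_length \<omega>2 = m"
      and word: "coding_word G J \<omega>1 = coding_word G J \<omega>2" for \<omega>1 \<omega>2
  proof -
    obtain p as q bs where eq [simp]: "\<omega>1 = (p, as)" "\<omega>2 = (q, bs)" by (cases \<omega>1, cases \<omega>2)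
    have walks: "\<exists>r. pre_digraph.awalk (coding_graph G J) p as r"
      "\<exists>r. pre_digraph.awalk (coding_graph G J) q bs r"
      using \<omega> by (simp_all only: eq mem_paths_iff)
    then have J: "p \<in> J" "q \<in> J"
      by (auto simp: pre_digraph.awalk_def coding_graph_def)
    have "\<exists>x\<in>inf_paths G. starts_with x (fst p) \<and> coded x (coding_word G J (p, as))"
      "\<exists>x\<in>inf_paths G. starts_with x (fst q) \<and> coded x (coding_word G J (q, bs))"
      using walks exists_coded[OF nonneg] by blast+
    then obtain x y where x: "x \<in> inf_paths G" "starts_with x (fst p)" "coded x (coding_word G J \<omega>1)"
      and y: "y \<in> inf_paths G" "starts_with y (fst q)" "coded y (coding_word G J \<omega>1)"
      using word by auto
    \<comment> \<open>A walk with \<open>m\<close> edges visits \<open>m + 1\<close> pairs, so its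
      code has one letter more than its length.\<close>
    have len_word: "length (coding_word G J \<omega>1) = Suc m"
      using len(1) by (simp add: coding_word_def pre_digraph.length_awalk_verts path_length_def)
    then have "coding_word G J \<omega>1 \<noteq> []" by auto
    with code_agreeI[OF x(1) y(1) x(3) y(3)] have "code_agree (Suc m) x y"
      using len_word by simp
    moreover have "d p \<le> Suc m"
      unfolding m_def using finite_J J by (simp add: le_SucI member_le_sum)
    \<comment> \<open>Now \<open>y\<close> starts with the first components of both \<open>p\<close>
      and \<open>q\<close>, and only one pair of \<open>J\<close> can have this property.\<close>
    ultimately have "starts_with y (fst p)"
      using d[OF J(1) code_agree_mono] x(2) by blast
    then have "p = q"
      using pair_of_eqI[OF y(1)] J y(2) by metis
    then show ?thesis by (simp add: path_src_def)
  qed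
  then show ?thesis unfolding left_synchronizing_def by blast
qed

end

theorem theorem5p8:
  fixes E :: "('v, 'e) pre_digraph"
    and J :: "('v, 'e) path_pair set"
    and \<Lambda> :: "('v, 'e) ncpoly set \<Rightarrow> ('v, 'e) ncpoly set"
  assumes "fin_digraph E" and "no_sinks E" and "no_sources E"
    and "every_cycle_has_exit E"
    and "admissible E J"
    and "is_coding_endo E J \<Lambda>"
    and "only_nonneg_edges E J"
    and "\<not> has_nonpos_cycle E J"
    and "\<not> left_synchronizing E J"
  shows "\<not> restricts_to_diagonal_iso E \<Lambda>"
proof -
  interpret coding_endo E J \<Lambda>
    using assms by (intro coding_endo.intro coding_endo_axioms.intro)
  show ?thesis
    using left_synchronizing_of_diagonal_iso assms by blast
qed

end
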